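(* Let $(\Omega,\rho)$ be a compact metric space and $m$ a Borel probability measure on $\Omega$ with no point masses. Let $T:L^2_{\mathbb R}(\Omega,m)\to L^2_{\mathbb R}(\Omega,m)$ be a compact linear operator, and let $\varphi:[0,\infty)\to[0,\infty)$ be a continuous increasing function whose inverse $\varphi^{-1}$ satisfies $$\varphi^{-1}(x)=x^{1/2}\,r(x^{-1/2})\qquad\text{for all }x>0$$ with a concave (or pseudo-concave) function $x\mapsto r(x)$ on $(0,\infty)$. (1) If $\mathrm{Lip}_1\subset T(B(L^2_{\mathbb R}(\Omega,m)))$ and $\sum_k\varphi(s_k(T))<\infty$, then for every Bessel sequence $(u_k)_{k\ge1}\subset L^2_0(\Omega,m)$, $$\sum_{k\ge1}\varphi(a\|u_k\|_{KR})<\infty\qquad\text{for a suitable }a>0 .$$ (2) If $\mathrm{Lip}_1\supset T(B(L^2_{\mathbb R}(\Omega,m)))$, then there exists an orthonormal sequence $(u_k)_{k\ge0}\subset L^2_0(\Omega,m)$ such that $$\|u_k\|_{KR}\ge s_k(T),\qquad k=0,1,\dots$$ In particular, $\sum_k h(\|u_k\|_{KR})=\infty$ for every $h$ for which $\sum_k h(s_k(T))=\infty$.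
   Context: All functions are real valued. $L^2_{\mathbb R}(\Omega,m)$ carries the inner product $(f,g)=\int_\Omega fg\,dm$, and $L^2_0(\Omega,m)=\{f\in L^2_{\mathbb R}(\Omega,m):\int_\Omega f\,dm=0\}$. A sequence $(u_k)$ in $L^2_0(\Omega,m)$ is a Bessel sequence if there is $B<\infty$ with $\sum_k|(f,u_k)|^2\le B^2\|f\|_2^2$ for all $f\in L^2_0(\Omega,m)$. Fix a point $x_0\in\Omega$ and put $$\mathrm{Lip}_1=\{f:\Omega\to\mathbb R:\ |f(x)-f(y)|\le\rho(x,y)\ \text{for all }x,y\in\Omega,\ f(x_0)=0\},$$ regarded as a compact subset of $L^2_{\mathbb R}(\Omega,m)$ (the choice of $x_0$ does not matter). $B(L^2_{\mathbb R}(\Omega,m))$ is the closed unit ball, and $s_0(T)\ge s_1(T)\ge\cdots$ are the singular numbers of the compact operator $T$. For $u\in L^2_0(\Omega,m)$, $\|u\|_{KR}$ is the Kantorovich--Rubinstein norm of the zero-mean signed measure $u\,dm$, i.e. the optimal cost, for the cost function $\rho(x,y)$, of transporting $u^+dm$ to $u^-dm$ (where $u^\pm=\max(0,\pm u)$); equivalently, $$\|u\|_{KR}=\sup\Big\{\int_\Omega uf\,dm:\ |f(x)-f(y)|\le\rho(x,y)\ \text{for all }x,y\in\Omega\Big\}.$$ In the functional equation for $\varphi^{-1}$, a function $r:(0,\infty)\to(0,\infty)$ is called pseudo-concave if $r(s)\le\max(1,s/t)\,r(t)$ for all $s,t>0$.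
   Formalization: In (2), false as stated, the bound ‖u_k‖_KR ≥ s_k(T) is proved when T has range in L²_0; for general T the bounds proved are s_k(PT), with P the projection onto L²_0, and s_{k+1}(T). The "in particular" clause is for nondecreasing h ≥ 0, since it fails for arbitrary h. *)

theory Defs
  imports "HOL-Probability.Probability"
begin

text \<open>
  The library has no type of square-integrable functions modulo null sets (and the measure is a
  variable here, so it cannot be a type).  Elements of $L^2_{\mathbb R}(\Omega,m)$ are therefore
  represented by functions, and equality in $L^2$ is equality almost everywhere.
\<close>

definition l2_space :: "'a measure \<Rightarrow> ('a \<Rightarrow> real) set" where
  "l2_space m = {f \<in> borel_measurable m. integrable m (\<lambda>x. (f x)\<^sup>2)}"

definition l2_inner :: "'a measure \<Rightarrow> ('a \<Rightarrow> real) \<Rightarrow> ('a \<Rightarrow> real) \<Rightarrow> real" where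
  "l2_inner m f g = (\<integral>x. f x * g x \<partial>m)"

definition l2_norm :: "'a measure \<Rightarrow> ('a \<Rightarrow> real) \<Rightarrow> real" where
  "l2_norm m f = sqrt (l2_inner m f f)"

definition l2_ball :: "'a measure \<Rightarrow> ('a \<Rightarrow> real) set" where
  "l2_ball m = {f \<in> l2_space m. l2_norm m f \<le> 1}"

definition l2_zero_mean :: "'a measure \<Rightarrow> ('a \<Rightarrow> real) set" where
  "l2_zero_mean m = {f \<in> l2_space m. (\<integral>x. f x \<partial>m) = 0}"

definition l2_subset :: "'a measure \<Rightarrow> ('a \<Rightarrow> real) set \<Rightarrow> ('a \<Rightarrow> real) set \<Rightarrow> bool" where
  "l2_subset m A B \<longleftrightarrow> (\<forall>f\<in>A. \<exists>g\<in>B. AE x in m. f x = g x)"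

definition l2_orthonormal :: "'a measure \<Rightarrow> nat set \<Rightarrow> (nat \<Rightarrow> 'a \<Rightarrow> real) \<Rightarrow> bool" where
  "l2_orthonormal m I u \<longleftrightarrow> (\<forall>i\<in>I. u i \<in> l2_space m) \<and>
     (\<forall>i\<in>I. \<forall>j\<in>I. l2_inner m (u i) (u j) = (if i = j then 1 else 0))"

definition l2_linear_operator :: "'a measure \<Rightarrow> (('a \<Rightarrow> real) \<Rightarrow> 'a \<Rightarrow> real) \<Rightarrow> bool" where
  "l2_linear_operator m T \<longleftrightarrow>
     (\<forall>f\<in>l2_space m. T f \<in> l2_space m) \<and>
     (\<forall>f\<in>l2_space m. \<forall>g\<in>l2_space m. (AE x in m. f x = g x) \<longrightarrow> (AE x in m. T f x = T g x)) \<and>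
     (\<forall>f\<in>l2_space m. \<forall>g\<in>l2_space m. AE x in m. T (\<lambda>y. f y + g y) x = T f x + T g x) \<and>
     (\<forall>c. \<forall>f\<in>l2_space m. AE x in m. T (\<lambda>y. c * f y) x = c * T f x)"

definition l2_compact_operator :: "'a measure \<Rightarrow> (('a \<Rightarrow> real) \<Rightarrow> 'a \<Rightarrow> real) \<Rightarrow> bool" where
  "l2_compact_operator m T \<longleftrightarrow> l2_linear_operator m T \<and>
     (\<forall>f :: nat \<Rightarrow> 'a \<Rightarrow> real. (\<forall>n. f n \<in> l2_ball m) \<longrightarrow>
        (\<exists>g\<in>l2_space m. \<exists>\<sigma> :: nat \<Rightarrow> nat. strict_mono \<sigma> \<and>
           (\<lambda>n. l2_norm m (\<lambda>x. T (f (\<sigma> n)) x - g x)) \<longlonglongrightarrow> 0))"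

text \<open>
  The eigenspace of $T^*T$ for the eigenvalue $c$: the equation $T^*Tf = cf$, tested against
  arbitrary $g$, reads $(Tf,Tg) = c(f,g)$.
\<close>

definition l2_eigenspace_TstarT ::
    "'a measure \<Rightarrow> (('a \<Rightarrow> real) \<Rightarrow> 'a \<Rightarrow> real) \<Rightarrow> real \<Rightarrow> ('a \<Rightarrow> real) set" where
  "l2_eigenspace_TstarT m T c =
     {f \<in> l2_space m. \<forall>g\<in>l2_space m. l2_inner m (T f) (T g) = c * l2_inner m f g}"

definition l2_has_dim :: "'a measure \<Rightarrow> ('a \<Rightarrow> real) set \<Rightarrow> nat \<Rightarrow> bool" where
  "l2_has_dim m E n \<longleftrightarrow>
     (\<exists>e. l2_orthonormal m {..<n} e \<and> (\<forall>i<n. e i \<in> E) \<and>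
          (\<forall>f\<in>E. AE x in m. f x = (\<Sum>i<n. l2_inner m f (e i) * e i x)))"

text \<open>
  The singular numbers of a compact operator $T$ are the eigenvalues of $(T^*T)^{1/2}$ in
  decreasing order, repeated according to multiplicity; the sequence is continued by zeros
  if $T$ has finite rank.  The level-set condition is imposed for every positive $\mu$; it
  says that $\mu$ does not occur at all if it is not an eigenvalue.
\<close>

definition singular_sequence ::
    "'a measure \<Rightarrow> (('a \<Rightarrow> real) \<Rightarrow> 'a \<Rightarrow> real) \<Rightarrow> (nat \<Rightarrow> real) \<Rightarrow> bool" where
  "singular_sequence m T s \<longleftrightarrow> decseq s \<and> (\<forall>k. 0 \<le> s k) \<and>
     (\<forall>\<mu>>0. finite {k. s k = \<mu>} \<and>
             l2_has_dim m (l2_eigenspace_TstarT m T (\<mu>\<^sup>2)) (card {k. s k = \<mu>}))"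

definition singular_number ::
    "'a measure \<Rightarrow> (('a \<Rightarrow> real) \<Rightarrow> 'a \<Rightarrow> real) \<Rightarrow> nat \<Rightarrow> real" where
  "singular_number m T = (THE s. singular_sequence m T s)"

definition bessel_sequence :: "'a measure \<Rightarrow> (nat \<Rightarrow> 'a \<Rightarrow> real) \<Rightarrow> bool" where
  "bessel_sequence m u \<longleftrightarrow> (\<forall>k. u k \<in> l2_zero_mean m) \<and>
     (\<exists>B. \<forall>f\<in>l2_zero_mean m.
        summable (\<lambda>k. \<bar>l2_inner m f (u k)\<bar>\<^sup>2) \<and>
        (\<Sum>k. \<bar>l2_inner m f (u k)\<bar>\<^sup>2) \<le> B\<^sup>2 * (l2_norm m f)\<^sup>2)"

definition Lip1 :: "'a::metric_space \<Rightarrow> ('a \<Rightarrow> real) set" where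
  "Lip1 x0 = {f. (\<forall>x y. \<bar>f x - f y\<bar> \<le> dist x y) \<and> f x0 = 0}"

text \<open>
  The dual form of the Kantorovich--Rubinstein norm of the signed measure $u\,dm$.  For zero-mean
  $u$ on a compact space the set of integrals is nonempty and bounded, so the supremum is
  the true one.
\<close>

definition kr_norm :: "'a::metric_space measure \<Rightarrow> ('a \<Rightarrow> real) \<Rightarrow> real" where
  "kr_norm m u = (SUP f\<in>{f. \<forall>x y. \<bar>f x - f y\<bar> \<le> dist x y}. \<integral>x. u x * f x \<partial>m)"

definition pseudo_concave :: "(real \<Rightarrow> real) \<Rightarrow> bool" where
  "pseudo_concave r \<longleftrightarrow> (\<forall>s>0. 0 < r s) \<and> (\<forall>s>0. \<forall>t>0. r s \<le> max 1 (s / t) * r t)"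

text \<open>
  The orthogonal projection of $L^2$ onto its zero-mean subspace $L^2_0$.  The norm above is
  only finite on $L^2_0$ and sees $1$-Lipschitz functions modulo constants, whereas a function in
  \<open>Lip1 x0\<close> need not have mean zero.  Write $P$ for this projection.  If
  $T(B) \subset \mathrm{Lip}_1$, an orthonormal sequence in $L^2_0$ with
  $\|u_k\|_{KR} \ge s_k(PT)$ exists; here $s_k(PT) \ge s_{k+1}(T)$, and $s_k(PT) = s_k(T)$ if the
  range of $T$ lies in $L^2_0$.  The bound with $s_k(T)$ is false without a
  condition of this kind: for Lebesgue measure on $[0,1]$, $x_0 = 0$ and $Tf(x) = x \int f$ one
  has $s_0(T) = 1/\sqrt 3$, but $\|u\|_{KR} \le 1/\sqrt{12}$ for all $u \in L^2_0$ with
  $\|u\|_2 = 1$.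
\<close>

definition l2_center :: "'a measure \<Rightarrow> ('a \<Rightarrow> real) \<Rightarrow> 'a \<Rightarrow> real" where
  "l2_center m f = (\<lambda>x. f x - (\<integral>y. f y \<partial>m))"

end

theory Submission
  imports Defs
begin

text \<open>
  The link between the two sides is the Schmidt expansion of $T$. There is an orthonormal sequence
  $f_0, f_1, \dots$ with $(Tf_k, Tg) = s_k^2 (f_k, g)$ for all $g$, where $s_k = \|Tf_k\|$ are the
  singular numbers; in particular the $Tf_k$ are orthogonal. It is obtained by choosing $f_k$ as a
  maximizer of $\|Tf\|$ among the unit vectors orthogonal to $f_0, \dots, f_{k-1}$. Maximizers
  exist because along a maximizing sequence whose images converge, the parallelogram law forces
  the sequence itself to be Cauchy (\<open>compact_operator_maximizer\<close>). A measure without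
  point masses has infinite-dimensional $L^2$, so the sequence never stops, and $f_k$ exists also
  when $s_k = 0$.

  \<^bold>\<open>Upper bound.\<close>  If every function of $\mathrm{Lip}_1$ is some $Tg$ with
  $\|g\| \le 1$, then expanding $Tg$ and using Cauchy-Schwarz gives $\|u\|_{KR}^2 \le \sum_j
  (Tf_j, u)^2 = \sum_j w_j(u) s_j^2$ with $w_j(u) = (Tf_j, u)^2 / s_j^2$
  (\<open>kr_norm_le_schmidt\<close>). For a Bessel sequence $(u_k)$ with bound $B$ the matrix
  $p_{kj} = w_j(u_k) / (B^2 + 1)$ is doubly substochastic: the row sums are bounded by Bessel's
  inequality for the normalized $Tf_j$ and $\|u_k\| \le B$, the column sums by the Bessel property
  of $(u_k)$. The hypothesis on $\varphi^{-1}$ says that $\varphi(y)/y^2$ is nondecreasing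
  (\<open>quotient_by_square_mono\<close>), which is almost convexity of $\varphi(\sqrt y)$ and
  yields Jensen's inequality with a loss of a factor $2$ (\<open>half_quadratic_jensen\<close>):
  $\varphi(a \|u_k\|_{KR}) \le \sum_j p_{kj} \varphi(s_j)$ for $a = (2 (B^2 + 1))^{-1/2}$. Now sum
  over $k$.

  \<^bold>\<open>Lower bound.\<close>  Let $P$ be the projection to the zero-mean functions and
  take the Schmidt expansion of $PT$, with singular numbers $\sigma_k$. Put $u_k = PTf_k /
  \sigma_k$ while $\sigma_k > 0$, and continue by any zero-mean unit vectors that keep the
  sequence orthonormal. If $T$ maps the unit ball into $\mathrm{Lip}_1$, then $Tf_k$ is an
  admissible test function for the Kantorovich-Rubinstein norm of $u_k$, and $(u_k, Tf_k) = (u_k,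
  PTf_k) = \sigma_k$. Passing from $T$ to $PT$ changes the operator by rank one, so $s_{k+1}(T)
  \le \sigma_k$ (\<open>schmidt_center_interlacing\<close>).
\<close>

section \<open>The space of square-integrable functions\<close>

lemma l2_space_measurable [measurable_dest]: "f \<in> l2_space M \<Longrightarrow> f \<in> borel_measurable M"
  by (simp add: l2_space_def)

lemma l2_space_integrable_mult:
  assumes "f \<in> l2_space M" "g \<in> l2_space M"
  shows "integrable M (\<lambda>x. f x * g x)"
proof (rule Bochner_Integration.integrable_bound)
  show "integrable M (\<lambda>x. (f x)\<^sup>2 + (g x)\<^sup>2)"
    using assms by (simp add: l2_space_def)
  show "(\<lambda>x. f x * g x) \<in> borel_measurable M"
    using assms by (auto simp: l2_space_def)
  have "\<bar>a * b\<bar> \<le> a\<^sup>2 + b\<^sup>2" for a b :: real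
  proof -
    have "0 \<le> (\<bar>a\<bar> - \<bar>b\<bar>)\<^sup>2 + (a\<^sup>2 + b\<^sup>2)" by simp
    then show ?thesis by (simp add: power2_diff abs_mult)
  qed
  then show "AE x in M. norm (f x * g x) \<le> norm ((f x)\<^sup>2 + (g x)\<^sup>2)"
    by (simp add: abs_mult)
qed

lemma l2_space_zero: "(\<lambda>x. 0) \<in> l2_space M"
  by (simp add: l2_space_def)

lemma l2_space_scale: "f \<in> l2_space M \<Longrightarrow> (\<lambda>x. c * f x) \<in> l2_space M"
  by (auto simp: l2_space_def power_mult_distrib)

lemma l2_space_add:
  assumes "f \<in> l2_space M" "g \<in> l2_space M"
  shows "(\<lambda>x. f x + g x) \<in> l2_space M"
  using assms l2_space_integrable_mult[OF assms]
  by (auto simp: l2_space_def power2_sum mult.assoc)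

lemma l2_space_diff:
  assumes "f \<in> l2_space M" "g \<in> l2_space M"
  shows "(\<lambda>x. f x - g x) \<in> l2_space M"
  using l2_space_add[OF assms(1) l2_space_scale[OF assms(2), of "-1"]] by simp

lemma l2_space_sum:
  assumes "\<And>i. i \<in> I \<Longrightarrow> f i \<in> l2_space M"
  shows "(\<lambda>x. \<Sum>i\<in>I. f i x) \<in> l2_space M"
  using assms
  by (induction I rule: infinite_finite_induct) (auto intro: l2_space_zero l2_space_add)

lemmas l2_space_closed = l2_space_zero l2_space_scale l2_space_add l2_space_diff l2_space_sum

lemma l2_inner_commute: "l2_inner M f g = l2_inner M g f"
  by (simp add: l2_inner_def mult.commute)

lemma l2_inner_add_left:
  "f \<in> l2_space M \<Longrightarrow> g \<in> l2_space M \<Longrightarrow> h \<in> l2_space M \<Longrightarrow>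
    l2_inner M (\<lambda>x. f x + g x) h = l2_inner M f h + l2_inner M g h"
  by (simp add: l2_inner_def distrib_right l2_space_integrable_mult)

lemma l2_inner_diff_left:
  "f \<in> l2_space M \<Longrightarrow> g \<in> l2_space M \<Longrightarrow> h \<in> l2_space M \<Longrightarrow>
    l2_inner M (\<lambda>x. f x - g x) h = l2_inner M f h - l2_inner M g h"
  by (simp add: l2_inner_def left_diff_distrib l2_space_integrable_mult)

lemma l2_inner_scale_left: "l2_inner M (\<lambda>x. c * f x) h = c * l2_inner M f h"
  by (simp add: l2_inner_def mult.assoc)

lemma l2_inner_zero_left: "l2_inner M (\<lambda>x. 0) h = 0"
  by (simp add: l2_inner_def)

lemma l2_inner_sum_left:
  assumes "\<And>i. i \<in> I \<Longrightarrow> f i \<in> l2_space M" "h \<in> l2_space M"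
  shows "l2_inner M (\<lambda>x. \<Sum>i\<in>I. f i x) h = (\<Sum>i\<in>I. l2_inner M (f i) h)"
  using assms(1)
  by (induction I rule: infinite_finite_induct)
    (auto simp: l2_inner_zero_left l2_inner_add_left l2_space_sum assms(2))

lemma l2_inner_add_right:
  "f \<in> l2_space M \<Longrightarrow> g \<in> l2_space M \<Longrightarrow> h \<in> l2_space M \<Longrightarrow>
    l2_inner M h (\<lambda>x. f x + g x) = l2_inner M h f + l2_inner M h g"
  by (simp add: l2_inner_def distrib_left l2_space_integrable_mult)

lemma l2_inner_diff_right:
  "f \<in> l2_space M \<Longrightarrow> g \<in> l2_space M \<Longrightarrow> h \<in> l2_space M \<Longrightarrow>
    l2_inner M h (\<lambda>x. f x - g x) = l2_inner M h f - l2_inner M h g"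
  by (simp add: l2_inner_def right_diff_distrib l2_space_integrable_mult)

lemma l2_inner_scale_right: "l2_inner M h (\<lambda>x. c * f x) = c * l2_inner M h f"
  by (simp add: l2_inner_def mult.left_commute)

lemma l2_inner_sum_right:
  assumes "\<And>i. i \<in> I \<Longrightarrow> f i \<in> l2_space M" "h \<in> l2_space M"
  shows "l2_inner M h (\<lambda>x. \<Sum>i\<in>I. f i x) = (\<Sum>i\<in>I. l2_inner M h (f i))"
  using l2_inner_sum_left[OF assms] by (simp only: l2_inner_commute[where g = h])

lemmas l2_inner_bilinear =
  l2_inner_add_left l2_inner_diff_left l2_inner_scale_left l2_inner_zero_left
  l2_inner_add_right l2_inner_diff_right l2_inner_scale_right

lemma l2_inner_cong_AE:
  assumes "f \<in> l2_space M" "f' \<in> l2_space M" "h \<in> l2_space M" "AE x in M. f x = f' x"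
  shows "l2_inner M f h = l2_inner M f' h"
  unfolding l2_inner_def by (rule integral_cong_AE) (use assms in \<open>auto simp: l2_space_def\<close>)

lemma l2_norm_nonneg: "0 \<le> l2_norm M f"
  by (simp add: l2_norm_def l2_inner_def)

lemma l2_norm_squared: "(l2_norm M f)\<^sup>2 = l2_inner M f f"
  by (simp add: l2_norm_def l2_inner_def)

lemma l2_inner_self_nonneg: "0 \<le> l2_inner M f f"
  by (simp add: l2_inner_def)

lemma l2_norm_scale: "l2_norm M (\<lambda>x. c * f x) = \<bar>c\<bar> * l2_norm M f"
  by (simp add: l2_norm_def l2_inner_bilinear real_sqrt_mult flip: mult.assoc power2_eq_square)

lemma l2_norm_zero: "l2_norm M (\<lambda>x. 0) = 0"
  by (simp add: l2_norm_def l2_inner_def)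

lemma l2_norm_eq_0_iff:
  assumes "f \<in> l2_space M"
  shows "l2_norm M f = 0 \<longleftrightarrow> (AE x in M. f x = 0)"
proof -
  have "l2_norm M f = 0 \<longleftrightarrow> (\<integral>x. (f x)\<^sup>2 \<partial>M) = 0"
    by (simp add: l2_norm_def l2_inner_def power2_eq_square)
  also have "\<dots> \<longleftrightarrow> (AE x in M. (f x)\<^sup>2 = 0)"
    by (rule integral_nonneg_eq_0_iff_AE) (use assms in \<open>auto simp: l2_space_def\<close>)
  finally show ?thesis by simp
qed

lemma l2_cauchy_schwarz:
  assumes f: "f \<in> l2_space M" and g: "g \<in> l2_space M"
  shows "\<bar>l2_inner M f g\<bar> \<le> l2_norm M f * l2_norm M g"
proof (cases "l2_norm M g = 0")
  case True
  then have "AE x in M. g x = 0" using l2_norm_eq_0_iff[OF g] by simp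
  then have "l2_inner M g f = l2_inner M (\<lambda>x. 0) f"
    by (rule l2_inner_cong_AE[OF g l2_space_zero f])
  then show ?thesis using True by (simp add: l2_inner_zero_left l2_inner_commute[of M f])
next
  case False
  define G where "G = l2_inner M g g"
  have G: "G > 0"
    using False l2_inner_self_nonneg[of M g] by (auto simp: G_def l2_norm_def less_le)
  have "0 \<le> l2_inner M (\<lambda>x. G * f x - l2_inner M f g * g x) (\<lambda>x. G * f x - l2_inner M f g * g x)"
    by (rule l2_inner_self_nonneg)
  also have "\<dots> = G * (G * l2_inner M f f - (l2_inner M f g)\<^sup>2)"
    using f g by (simp add: l2_inner_bilinear l2_space_closed l2_inner_commute[of M g f]
        flip: G_def) (simp add: algebra_simps power2_eq_square)
  finally have "(l2_inner M f g)\<^sup>2 \<le> G * l2_inner M f f"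
    using G by (simp add: zero_le_mult_iff)
  then have "(l2_inner M f g)\<^sup>2 \<le> (l2_norm M f * l2_norm M g)\<^sup>2"
    by (simp add: power_mult_distrib l2_norm_squared G_def mult.commute)
  then show ?thesis
    using abs_le_square_iff l2_norm_nonneg[of M f] l2_norm_nonneg[of M g]
    by (metis abs_of_nonneg mult_nonneg_nonneg)
qed

lemma l2_norm_triangle:
  assumes f: "f \<in> l2_space M" and g: "g \<in> l2_space M"
  shows "l2_norm M (\<lambda>x. f x + g x) \<le> l2_norm M f + l2_norm M g"
proof (rule power2_le_imp_le)
  have "(l2_norm M (\<lambda>x. f x + g x))\<^sup>2 = (l2_norm M f)\<^sup>2 + (l2_norm M g)\<^sup>2 + 2 * l2_inner M f g"
    using f g by (simp add: l2_norm_squared l2_inner_bilinear l2_space_closed l2_inner_commute[of M g f])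
  also have "\<dots> \<le> (l2_norm M f + l2_norm M g)\<^sup>2"
    using l2_cauchy_schwarz[OF f g] by (simp add: power2_sum)
  finally show "(l2_norm M (\<lambda>x. f x + g x))\<^sup>2 \<le> (l2_norm M f + l2_norm M g)\<^sup>2" .
  show "0 \<le> l2_norm M f + l2_norm M g"
    by (simp add: l2_norm_nonneg)
qed

lemma l2_norm_diff_commute: "l2_norm M (\<lambda>x. f x - g x) = l2_norm M (\<lambda>x. g x - f x)"
  using l2_norm_scale[of M "-1" "\<lambda>x. f x - g x"] by simp

lemma l2_norm_triangle_diff:
  assumes f: "f \<in> l2_space M" and g: "g \<in> l2_space M"
  shows "\<bar>l2_norm M f - l2_norm M g\<bar> \<le> l2_norm M (\<lambda>x. f x - g x)"
  using l2_norm_triangle[OF g l2_space_diff[OF f g]] l2_norm_triangle[OF f l2_space_diff[OF g f]]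
    l2_norm_diff_commute[of M f g]
  by simp

lemma l2_norm_triangle_via:
  assumes "f \<in> l2_space M" "g \<in> l2_space M" "h \<in> l2_space M"
  shows "l2_norm M (\<lambda>x. f x - g x) \<le> l2_norm M (\<lambda>x. f x - h x) + l2_norm M (\<lambda>x. g x - h x)"
  using l2_norm_triangle[OF l2_space_diff[OF assms(1,3)] l2_space_diff[OF assms(3,2)]]
    l2_norm_diff_commute[of M g h]
  by simp

lemma l2_norm_tendsto:
  assumes "\<And>n. F n \<in> l2_space M" "g \<in> l2_space M"
    and "(\<lambda>n. l2_norm M (\<lambda>x. F n x - g x)) \<longlonglongrightarrow> 0"
  shows "(\<lambda>n. l2_norm M (F n)) \<longlonglongrightarrow> l2_norm M g"
  by (rule LIM_zero_cancel, rule Lim_null_comparison[OF _ assms(3)])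
    (use l2_norm_triangle_diff assms(1,2) in \<open>auto intro!: always_eventually\<close>)

lemma l2_inner_tendsto:
  assumes "\<And>n. F n \<in> l2_space M" "g \<in> l2_space M" "h \<in> l2_space M"
    and lim: "(\<lambda>n. l2_norm M (\<lambda>x. F n x - g x)) \<longlonglongrightarrow> 0"
  shows "(\<lambda>n. l2_inner M (F n) h) \<longlonglongrightarrow> l2_inner M g h"
proof (rule LIM_zero_cancel, rule Lim_null_comparison)
  show "(\<lambda>n. l2_norm M (\<lambda>x. F n x - g x) * l2_norm M h) \<longlonglongrightarrow> 0"
    using tendsto_mult_right[OF lim] by simp
  show "\<forall>\<^sub>F n in sequentially. norm (l2_inner M (F n) h - l2_inner M g h)
      \<le> l2_norm M (\<lambda>x. F n x - g x) * l2_norm M h"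
    using l2_cauchy_schwarz[OF l2_space_diff[OF assms(1,2)] assms(3)]
    by (simp add: l2_inner_diff_left assms(1-3))
qed

lemma (in prob_space) l2_space_const: "(\<lambda>x. c) \<in> l2_space M"
  by (simp add: l2_space_def)

lemma (in prob_space) l2_space_integrable:
  assumes "f \<in> l2_space M"
  shows "integrable M f"
  using l2_space_integrable_mult[OF assms l2_space_const[of 1]] by simp

lemma (in prob_space) integral_abs_le_l2_norm:
  assumes f: "f \<in> l2_space M"
  shows "(\<integral>x. \<bar>f x\<bar> \<partial>M) \<le> l2_norm M f"
proof -
  have af: "(\<lambda>x. \<bar>f x\<bar>) \<in> l2_space M"
    using f by (auto simp: l2_space_def)
  have "(\<integral>x. \<bar>f x\<bar> \<partial>M) = l2_inner M (\<lambda>x. \<bar>f x\<bar>) (\<lambda>x. 1)"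
    by (simp add: l2_inner_def)
  also have "\<dots> \<le> l2_norm M (\<lambda>x. \<bar>f x\<bar>) * l2_norm M (\<lambda>x. 1)"
    using l2_cauchy_schwarz[OF af l2_space_const[of 1]] by simp
  also have "\<dots> = l2_norm M f"
    by (simp add: l2_norm_def l2_inner_def prob_space)
  finally show ?thesis .
qed

text \<open>
  The completeness part of the Riesz-Fischer theorem: an $L^2$-Cauchy sequence is $L^1$-Cauchy, so
  a subsequence converges almost everywhere, and Fatou's lemma bounds the distance to the
  pointwise limit. The Cauchy condition is a bound on the squared distance that splits into two
  null sequences, because the parallelogram law produces it in this form.
\<close>

lemma (in prob_space) l2_complete:
  assumes F: "\<And>n. F n \<in> l2_space M"
    and cauchy: "\<And>a b. (l2_norm M (\<lambda>x. F a x - F b x))\<^sup>2 \<le> \<epsilon> a + \<epsilon> b"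
    and \<epsilon>: "\<epsilon> \<longlonglongrightarrow> 0"
  obtains g where "g \<in> l2_space M" "(\<lambda>n. l2_norm M (\<lambda>x. F n x - g x)) \<longlonglongrightarrow> 0"
proof -
  have [measurable]: "F n \<in> borel_measurable M" for n
    using F by (rule l2_space_measurable)
  have "\<exists>N. \<forall>i\<ge>N. \<forall>j\<ge>N. (\<integral>x. norm (F i x - F j x) \<partial>M) < e" if "e > 0" for e
  proof -
    have "\<forall>\<^sub>F n in sequentially. \<epsilon> n < e\<^sup>2 / 2"
      using order_tendstoD(2)[OF \<epsilon>, of "e\<^sup>2 / 2"] that by simp
    then obtain N where N: "\<And>n. n \<ge> N \<Longrightarrow> \<epsilon> n < e\<^sup>2 / 2"
      by (auto simp: eventually_sequentially)
    have "(\<integral>x. norm (F i x - F j x) \<partial>M) < e" if ij: "i \<ge> N" "j \<ge> N" for i j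
    proof -
      have "(l2_norm M (\<lambda>x. F i x - F j x))\<^sup>2 < e\<^sup>2"
        using cauchy[of i j] N[OF ij(1)] N[OF ij(2)] by linarith
      then have "l2_norm M (\<lambda>x. F i x - F j x) < e"
        using \<open>e > 0\<close> by (simp add: power_less_imp_less_base)
      then show ?thesis
        using integral_abs_le_l2_norm[OF l2_space_diff[OF F F], of i j] by simp
    qed
    then show ?thesis by blast
  qed
  from cauchy_L1_AE_cauchy_subseq[OF l2_space_integrable[OF F] this]
  obtain r where r: "strict_mono r" and ae: "AE x in M. Cauchy (\<lambda>i. F (r i) x)" by blast
  define g where "g = (\<lambda>x. lim (\<lambda>i. F (r i) x))"
  have [measurable]: "g \<in> borel_measurable M"
    unfolding g_def by measurable
  have conv: "AE x in M. (\<lambda>i. F (r i) x) \<longlonglongrightarrow> g x"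
    using ae by eventually_elim (auto simp: g_def Cauchy_convergent_iff convergent_LIMSEQ_iff)
  have sq: "(\<integral>\<^sup>+x. ennreal ((F i x - F j x)\<^sup>2) \<partial>M) \<le> ennreal (\<epsilon> i + \<epsilon> j)" for i j
  proof -
    have "(\<integral>\<^sup>+x. ennreal ((F i x - F j x)\<^sup>2) \<partial>M) = ennreal (\<integral>x. (F i x - F j x)\<^sup>2 \<partial>M)"
      by (rule nn_integral_eq_integral) (use l2_space_diff[OF F F] in \<open>auto simp: l2_space_def\<close>)
    also have "(\<integral>x. (F i x - F j x)\<^sup>2 \<partial>M) = (l2_norm M (\<lambda>x. F i x - F j x))\<^sup>2"
      by (simp add: l2_norm_squared) (simp add: l2_inner_def power2_eq_square)
    finally show ?thesis using cauchy[of i j] by (simp add: ennreal_leI)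
  qed
  have lim_sq: "(\<integral>\<^sup>+x. ennreal ((F i x - g x)\<^sup>2) \<partial>M) \<le> ennreal (\<epsilon> i)" for i
  proof -
    have "(\<integral>\<^sup>+x. ennreal ((F i x - g x)\<^sup>2) \<partial>M)
        = (\<integral>\<^sup>+x. liminf (\<lambda>j. ennreal ((F i x - F (r j) x)\<^sup>2)) \<partial>M)"
    proof (rule nn_integral_cong_AE, use conv in eventually_elim)
      case (elim x)
      then have "(\<lambda>j. ennreal ((F i x - F (r j) x)\<^sup>2)) \<longlonglongrightarrow> ennreal ((F i x - g x)\<^sup>2)"
        by (intro tendsto_intros)
      then show ?case by (rule lim_imp_Liminf[OF trivial_limit_sequentially, symmetric])
    qed
    also have "\<dots> \<le> liminf (\<lambda>j. \<integral>\<^sup>+x. ennreal ((F i x - F (r j) x)\<^sup>2) \<partial>M)"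
      by (rule nn_integral_liminf) measurable
    also have "\<dots> \<le> liminf (\<lambda>j. ennreal (\<epsilon> i + \<epsilon> (r j)))"
      by (rule Liminf_mono) (simp add: sq)
    also have "\<dots> = ennreal (\<epsilon> i)"
    proof (rule lim_imp_Liminf)
      have "(\<lambda>j. ennreal (\<epsilon> i + \<epsilon> (r j))) \<longlonglongrightarrow> ennreal (\<epsilon> i + 0)"
        using LIMSEQ_subseq_LIMSEQ[OF \<epsilon> r] by (intro tendsto_intros) (simp add: comp_def)
      then show "(\<lambda>j. ennreal (\<epsilon> i + \<epsilon> (r j))) \<longlonglongrightarrow> ennreal (\<epsilon> i)" by simp
    qed simp
    finally show ?thesis .
  qed
  have diff: "(\<lambda>x. F i x - g x) \<in> l2_space M" for i
    unfolding l2_space_def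
  proof (intro CollectI conjI)
    show "integrable M (\<lambda>x. (F i x - g x)\<^sup>2)"
      using lim_sq[of i] by (intro integrableI_bounded) (auto simp: order_le_less_trans)
  qed measurable
  show thesis
  proof
    show "g \<in> l2_space M"
      using l2_space_diff[OF F diff, of 0 0] by simp
    have \<epsilon>_nonneg: "0 \<le> \<epsilon> i" for i
      using cauchy[of i i] by (smt (verit) zero_le_power2)
    have bound: "l2_norm M (\<lambda>x. F i x - g x) \<le> sqrt (\<epsilon> i)" for i
    proof -
      have "ennreal ((l2_norm M (\<lambda>x. F i x - g x))\<^sup>2) = (\<integral>\<^sup>+x. ennreal ((F i x - g x)\<^sup>2) \<partial>M)"
        using diff[of i]
        by (subst nn_integral_eq_integral)
          (auto simp: l2_space_def l2_norm_squared, simp add: l2_inner_def power2_eq_square)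
      then have "ennreal ((l2_norm M (\<lambda>x. F i x - g x))\<^sup>2) \<le> ennreal (\<epsilon> i)"
        using lim_sq by simp
      then show ?thesis
        using \<epsilon>_nonneg by (simp add: real_le_rsqrt)
    qed
    have "(\<lambda>i. sqrt (\<epsilon> i)) \<longlonglongrightarrow> 0"
      using tendsto_real_sqrt[OF \<epsilon>] by simp
    then show "(\<lambda>n. l2_norm M (\<lambda>x. F n x - g x)) \<longlonglongrightarrow> 0"
      by (rule metric_tendsto_imp_tendsto) (simp_all add: bound l2_norm_nonneg \<epsilon>_nonneg)
  qed
qed

section \<open>Orthonormal systems and infinite dimension\<close>

text \<open>
  Elimination of one unknown per equation. All dimension counts below rest on this fact.
\<close>

lemma homogeneous_system_nontrivial_solution:
  fixes A :: "nat \<Rightarrow> 'b \<Rightarrow> real"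
  assumes "finite J" "n < card J"
  shows "\<exists>c. (\<exists>j\<in>J. c j \<noteq> 0) \<and> (\<forall>i<n. (\<Sum>j\<in>J. A i j * c j) = 0)"
  using assms
proof (induction n arbitrary: J A)
  case 0
  then obtain j where "j \<in> J" by fastforce
  then show ?case by (intro exI[of _ "\<lambda>_. 1"]) auto
next
  case (Suc n)
  show ?case
  proof (cases "\<forall>j\<in>J. A n j = 0")
    case True
    obtain c where "\<exists>j\<in>J. c j \<noteq> 0" "\<forall>i<n. (\<Sum>j\<in>J. A i j * c j) = 0"
      using Suc.IH[of J A] Suc.prems by auto
    then show ?thesis using True by (intro exI[of _ c]) (auto simp: less_Suc_eq)
  next
    case False
    then obtain p where p: "p \<in> J" "A n p \<noteq> 0" by blast
    define K where "K = J - {p}"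
    have K: "finite K" "p \<notin> K" "J = insert p K" "n < card K"
      using Suc.prems p by (auto simp: K_def)
    define B where "B i j = A i j - A i p * A n j / A n p" for i j
    obtain c where c: "\<exists>j\<in>K. c j \<noteq> 0" "\<And>i. i < n \<Longrightarrow> (\<Sum>j\<in>K. B i j * c j) = 0"
      using Suc.IH[OF K(1,4), of B] by auto
    define S where "S = (\<Sum>j\<in>K. A n j * c j)"
    define d where "d = c(p := - S / A n p)"
    have dK: "(\<Sum>j\<in>K. A i j * d j) = (\<Sum>j\<in>K. A i j * c j)" for i
      using K(2) by (intro sum.cong) (auto simp: d_def)
    have "(\<Sum>j\<in>J. A i j * d j) = 0" if "i < Suc n" for i
    proof (cases "i = n")
      case True
      then show ?thesis
        using K p(2) dK[of n] by (simp add: d_def S_def)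
    next
      case False
      have "(\<Sum>j\<in>K. B i j * c j) = (\<Sum>j\<in>K. A i j * c j) - A i p / A n p * S"
        by (simp add: B_def S_def left_diff_distrib sum_subtractf sum_distrib_left mult.assoc)
      then show ?thesis
        using K p(2) dK[of i] c(2)[of i] that False by (simp add: d_def)
    qed
    moreover have "\<exists>j\<in>J. d j \<noteq> 0"
      using c(1) K by (auto simp: d_def)
    ultimately show ?thesis by blast
  qed
qed

lemma l2_orthonormal_inner_combination:
  assumes e: "l2_orthonormal M I e" and I: "finite J" "J \<subseteq> I" "k \<in> I"
  shows "l2_inner M (\<lambda>x. \<Sum>j\<in>J. c j * e j x) (e k) = (if k \<in> J then c k else 0)"
proof -
  have "l2_inner M (\<lambda>x. \<Sum>j\<in>J. c j * e j x) (e k) = (\<Sum>j\<in>J. c j * l2_inner M (e j) (e k))"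
    using e I by (subst l2_inner_sum_left) (auto simp: l2_inner_scale_left l2_orthonormal_def
        intro!: l2_space_scale)
  also have "\<dots> = (\<Sum>j\<in>J. if k = j then c j else 0)"
    using e I by (intro sum.cong) (auto simp: l2_orthonormal_def)
  finally show ?thesis using I(1) by simp
qed

lemma l2_orthonormal_combination_norm:
  assumes e: "l2_orthonormal M I e" and I: "finite I"
  shows "l2_inner M (\<lambda>x. \<Sum>j\<in>I. c j * e j x) (\<lambda>x. \<Sum>j\<in>I. c j * e j x) = (\<Sum>j\<in>I. (c j)\<^sup>2)"
proof -
  have "l2_inner M (\<lambda>x. \<Sum>j\<in>I. c j * e j x) (\<lambda>x. \<Sum>j\<in>I. c j * e j x)
      = (\<Sum>k\<in>I. c k * l2_inner M (\<lambda>x. \<Sum>j\<in>I. c j * e j x) (e k))"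
    using e by (subst l2_inner_sum_right) (auto simp: l2_inner_scale_right l2_orthonormal_def
        intro!: l2_space_scale l2_space_sum)
  also have "\<dots> = (\<Sum>j\<in>I. (c j)\<^sup>2)"
    using l2_orthonormal_inner_combination[OF e I subset_refl]
    by (intro sum.cong) (auto simp: power2_eq_square)
  finally show ?thesis .
qed

lemma l2_bessel_inequality:
  assumes e: "l2_orthonormal M I e" and I: "finite I" and f: "f \<in> l2_space M"
  defines "q \<equiv> \<lambda>x. \<Sum>i\<in>I. l2_inner M f (e i) * e i x"
  shows "l2_inner M (\<lambda>x. f x - q x) (\<lambda>x. f x - q x) = l2_inner M f f - (\<Sum>i\<in>I. (l2_inner M f (e i))\<^sup>2)"
    and "(\<Sum>i\<in>I. (l2_inner M f (e i))\<^sup>2) \<le> l2_inner M f f"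
proof -
  have el2: "i \<in> I \<Longrightarrow> e i \<in> l2_space M" for i using e by (simp add: l2_orthonormal_def)
  have q: "q \<in> l2_space M"
    unfolding q_def by (intro l2_space_sum l2_space_scale el2)
  have "l2_inner M q f = (\<Sum>i\<in>I. l2_inner M f (e i) * l2_inner M (e i) f)"
    unfolding q_def using el2 f
    by (subst l2_inner_sum_left) (auto simp: l2_inner_scale_left l2_space_scale)
  then have "l2_inner M q f = (\<Sum>i\<in>I. (l2_inner M f (e i))\<^sup>2)"
    by (simp add: power2_eq_square l2_inner_commute)
  moreover have "l2_inner M q q = (\<Sum>i\<in>I. (l2_inner M f (e i))\<^sup>2)"
    unfolding q_def by (rule l2_orthonormal_combination_norm[OF e I])
  ultimately show eq: "l2_inner M (\<lambda>x. f x - q x) (\<lambda>x. f x - q x)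
      = l2_inner M f f - (\<Sum>i\<in>I. (l2_inner M f (e i))\<^sup>2)"
    using f q l2_inner_commute[of M f q] by (simp add: l2_inner_bilinear l2_space_closed)
  show "(\<Sum>i\<in>I. (l2_inner M f (e i))\<^sup>2) \<le> l2_inner M f f"
    using eq l2_inner_self_nonneg[of M "\<lambda>x. f x - q x"] by simp
qed

lemma l2_normalize:
  assumes "f \<in> l2_space M" "l2_norm M f \<noteq> 0"
  shows "(\<lambda>x. 1 / l2_norm M f * f x) \<in> l2_space M" "l2_norm M (\<lambda>x. 1 / l2_norm M f * f x) = 1"
  using assms l2_norm_nonneg[of M f] by (simp_all only: l2_space_scale l2_norm_scale) simp

text \<open>
  Infinite dimension in the form in which the greedy constructions consume it: every step needs a
  unit vector orthogonal to the finitely many vectors chosen so far.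
\<close>

locale infinite_dim_l2 = prob_space +
  assumes ex_unit_orthogonal:
    "\<And>n w. (\<And>i. i < n \<Longrightarrow> w i \<in> l2_space M) \<Longrightarrow>
      \<exists>f\<in>l2_space M. l2_norm M f = 1 \<and> (\<forall>i<(n::nat). l2_inner M f (w i) = 0)"

section \<open>Compact operators\<close>

lemma l2_operator_closed: "l2_linear_operator M T \<Longrightarrow> f \<in> l2_space M \<Longrightarrow> T f \<in> l2_space M"
  by (simp add: l2_linear_operator_def)

lemma l2_operator_inner_add:
  assumes T: "l2_linear_operator M T" and f: "f \<in> l2_space M" "g \<in> l2_space M" "h \<in> l2_space M"
  shows "l2_inner M (T (\<lambda>x. f x + g x)) h = l2_inner M (T f) h + l2_inner M (T g) h"
proof -
  have "l2_inner M (T (\<lambda>x. f x + g x)) h = l2_inner M (\<lambda>x. T f x + T g x) h"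
    using T f by (intro l2_inner_cong_AE l2_space_add l2_operator_closed[OF T])
      (auto simp: l2_linear_operator_def)
  then show ?thesis using T f by (simp add: l2_inner_add_left l2_operator_closed[OF T])
qed

lemma l2_operator_inner_scale:
  assumes T: "l2_linear_operator M T" and f: "f \<in> l2_space M" "h \<in> l2_space M"
  shows "l2_inner M (T (\<lambda>x. c * f x)) h = c * l2_inner M (T f) h"
proof -
  have "l2_inner M (T (\<lambda>x. c * f x)) h = l2_inner M (\<lambda>x. c * T f x) h"
    using T f by (intro l2_inner_cong_AE l2_space_scale l2_operator_closed[OF T])
      (auto simp: l2_linear_operator_def)
  then show ?thesis by (simp add: l2_inner_scale_left)
qed

lemma l2_operator_inner_diff:
  assumes T: "l2_linear_operator M T" and f: "f \<in> l2_space M" "g \<in> l2_space M" "h \<in> l2_space M"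
  shows "l2_inner M (T (\<lambda>x. f x - g x)) h = l2_inner M (T f) h - l2_inner M (T g) h"
  using l2_operator_inner_add[OF T f(1) l2_space_scale[OF f(2), of "-1"] f(3)]
    l2_operator_inner_scale[OF T f(2,3), of "-1"]
  by simp

lemma l2_operator_inner_sum:
  assumes T: "l2_linear_operator M T" and f: "\<And>i. i \<in> I \<Longrightarrow> f i \<in> l2_space M"
    and h: "h \<in> l2_space M"
  shows "l2_inner M (T (\<lambda>x. \<Sum>i\<in>I. c i * f i x)) h = (\<Sum>i\<in>I. c i * l2_inner M (T (f i)) h)"
  using f
proof (induction I rule: infinite_finite_induct)
  case (insert i I)
  then have "l2_inner M (T (\<lambda>x. c i * f i x + (\<Sum>i\<in>I. c i * f i x))) h
      = c i * l2_inner M (T (f i)) h + (\<Sum>i\<in>I. c i * l2_inner M (T (f i)) h)"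
    using h T by (subst l2_operator_inner_add)
      (auto simp: l2_operator_inner_scale intro!: l2_space_scale l2_space_sum)
  then show ?case using insert by simp
qed (use l2_operator_inner_scale[OF T l2_space_zero h, of 0] in simp_all)

lemma l2_operator_norm_scale:
  assumes T: "l2_linear_operator M T" and f: "f \<in> l2_space M"
  shows "l2_norm M (T (\<lambda>x. c * f x)) = \<bar>c\<bar> * l2_norm M (T f)"
proof -
  have "l2_inner M (T (\<lambda>x. c * f x)) (T (\<lambda>x. c * f x)) = c\<^sup>2 * l2_inner M (T f) (T f)"
    using T f l2_inner_commute[of M "T f" "T (\<lambda>x. c * f x)"]
    by (simp add: l2_operator_inner_scale l2_operator_closed[OF T] l2_space_scale power2_eq_square)
  then show ?thesis by (simp add: l2_norm_def real_sqrt_mult)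
qed

lemma l2_operator_norm_diff:
  assumes T: "l2_linear_operator M T" and f: "f \<in> l2_space M" "g \<in> l2_space M"
  shows "l2_norm M (T (\<lambda>x. f x - g x)) = l2_norm M (\<lambda>x. T f x - T g x)"
proof -
  have "AE x in M. T (\<lambda>y. f y + (- 1) * g y) x = T f x + T (\<lambda>y. (- 1) * g y) x"
    "AE x in M. T (\<lambda>y. (- 1) * g y) x = - 1 * T g x"
    using T f l2_space_scale[OF f(2), of "-1"] by (simp_all only: l2_linear_operator_def)
  then have "AE x in M. T (\<lambda>y. f y - g y) x = T f x - T g x"
    by eventually_elim simp
  moreover have [measurable]: "T (\<lambda>y. f y - g y) \<in> borel_measurable M"
    "T f \<in> borel_measurable M" "T g \<in> borel_measurable M"
    using f by (auto intro!: l2_space_measurable l2_operator_closed[OF T] l2_space_diff)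
  ultimately have "l2_inner M (T (\<lambda>y. f y - g y)) (T (\<lambda>y. f y - g y))
      = l2_inner M (\<lambda>x. T f x - T g x) (\<lambda>x. T f x - T g x)"
    unfolding l2_inner_def by (intro integral_cong_AE) auto
  then show ?thesis by (simp add: l2_norm_def)
qed

lemma l2_compact_operator_linear: "l2_compact_operator M T \<Longrightarrow> l2_linear_operator M T"
  by (simp add: l2_compact_operator_def)

text \<open>
  If \<open>T\<close> were unbounded on the unit ball, a sequence with $\|Tf_n\| > n$ would have
  no subsequence with convergent images.
\<close>

lemma l2_compact_operator_bounded:
  assumes T: "l2_compact_operator M T"
  obtains C where "0 \<le> C" "\<And>f. f \<in> l2_space M \<Longrightarrow> l2_norm M (T f) \<le> C * l2_norm M f"
proof -
  note lin = l2_compact_operator_linear[OF T]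
  have "\<exists>C. \<forall>f\<in>l2_ball M. l2_norm M (T f) \<le> C"
  proof (rule ccontr)
    assume "\<not> ?thesis"
    then have "\<forall>n::nat. \<exists>f\<in>l2_ball M. real n < l2_norm M (T f)"
      by (meson not_le)
    then obtain f where f: "\<And>n. f n \<in> l2_ball M" "\<And>n. real n < l2_norm M (T (f n))"
      by metis
    obtain g \<sigma> where g: "g \<in> l2_space M" and \<sigma>: "strict_mono (\<sigma> :: nat \<Rightarrow> nat)"
      and lim: "(\<lambda>n. l2_norm M (\<lambda>x. T (f (\<sigma> n)) x - g x)) \<longlonglongrightarrow> 0"
      using T f(1) unfolding l2_compact_operator_def by blast
    have "(\<lambda>n. l2_norm M (T (f (\<sigma> n)))) \<longlonglongrightarrow> l2_norm M g"
      using f(1) lin g lim by (intro l2_norm_tendsto) (auto simp: l2_ball_def l2_operator_closed[OF lin])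
    then have "Bseq (\<lambda>n. l2_norm M (T (f (\<sigma> n))))"
      using convergentI convergent_imp_Bseq by blast
    then obtain K where K: "\<And>n. norm (l2_norm M (T (f (\<sigma> n)))) \<le> K"
      unfolding Bseq_def by blast
    obtain n :: nat where n: "K < real n"
      using reals_Archimedean2 by blast
    have "real n \<le> real (\<sigma> n)" using seq_suble[OF \<sigma>, of n] by simp
    then show False using K[of n] f(2)[of "\<sigma> n"] n by simp
  qed
  then obtain C where C: "\<And>f. f \<in> l2_ball M \<Longrightarrow> l2_norm M (T f) \<le> C" by blast
  have C0: "0 \<le> C"
    using C[of "\<lambda>x. 0"] l2_norm_nonneg[of M "T (\<lambda>x. 0)"]
    by (simp add: l2_ball_def l2_space_zero l2_norm_zero)
  have "l2_norm M (T f) \<le> C * l2_norm M f" if f: "f \<in> l2_space M" for f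
  proof (cases "l2_norm M f = 0")
    case True
    have "t * l2_norm M (T f) \<le> C" if "t > 0" for t
      using C[of "\<lambda>x. t * f x"] that True f lin
      by (simp add: l2_ball_def l2_space_scale l2_norm_scale l2_operator_norm_scale)
    from this[of "(C + 1) / l2_norm M (T f)"] have "l2_norm M (T f) = 0"
      using C0 l2_norm_nonneg[of M "T f"] by (cases "l2_norm M (T f) = 0") auto
    then show ?thesis using C0 True by simp
  next
    case False
    have "1 / l2_norm M f * l2_norm M (T f) \<le> C"
      using C[of "\<lambda>x. 1 / l2_norm M f * f x"] l2_normalize[OF f False] lin f
        l2_operator_norm_scale[OF lin f, of "1 / l2_norm M f"] l2_norm_nonneg[of M f]
      by (simp add: l2_ball_def)
    then show ?thesis
      using False l2_norm_nonneg[of M f] by (simp add: field_simps)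
  qed
  with C0 show thesis by (rule that)
qed

text \<open>
  Let $S > 0$ be the supremum of $\|Tf\|$ over the unit ball of the orthogonal complement of the
  $w_i$, and $\|Tf_n\| \to S$. After passing to a subsequence the images converge, so $\|T(f_a +
  f_b)\|$ is close to $2S$ and $\|f_a + f_b\|$ close to $2$. By the parallelogram law $\|f_a -
  f_b\|$ is then small, and the limit of the sequence is a maximizer. If $S = 0$, any unit vector
  in the complement is one.
\<close>

lemma (in infinite_dim_l2) compact_operator_maximizer:
  assumes T: "l2_compact_operator M T" and w: "\<And>i. i < n \<Longrightarrow> w i \<in> l2_space M"
  obtains f where "f \<in> l2_space M" "l2_norm M f = 1" "\<And>i. i < (n::nat) \<Longrightarrow> l2_inner M f (w i) = 0"
    "\<And>g. g \<in> l2_space M \<Longrightarrow> (\<And>i. i < n \<Longrightarrow> l2_inner M g (w i) = 0) \<Longrightarrow>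
      l2_norm M (T g) \<le> l2_norm M (T f) * l2_norm M g"
proof -
  note lin = l2_compact_operator_linear[OF T]
  obtain C where C: "0 \<le> C" "\<And>f. f \<in> l2_space M \<Longrightarrow> l2_norm M (T f) \<le> C * l2_norm M f"
    using l2_compact_operator_bounded[OF T] by blast
  define W where "W = {f \<in> l2_space M. \<forall>i<n. l2_inner M f (w i) = 0}"
  have W_l2: "f \<in> l2_space M" if "f \<in> W" for f using that by (simp add: W_def)
  have W_scale: "(\<lambda>x. c * f x) \<in> W" if "f \<in> W" for f c
    using that by (simp add: W_def l2_space_scale l2_inner_scale_left)
  have W_add: "(\<lambda>x. f x + g x) \<in> W" if "f \<in> W" "g \<in> W" for f g
    using that w by (simp add: W_def l2_space_add l2_inner_add_left)
  define V where "V = (\<lambda>f. l2_norm M (T f)) ` (W \<inter> l2_ball M)"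
  define S where "S = Sup V"
  have bdd: "bdd_above V"
    unfolding V_def
  proof (rule bdd_aboveI2)
    fix f assume "f \<in> W \<inter> l2_ball M"
    then show "l2_norm M (T f) \<le> C"
      using C(2)[of f] mult_left_mono[OF _ C(1), of "l2_norm M f" 1] by (simp add: l2_ball_def)
  qed
  have zero_W: "(\<lambda>x. 0) \<in> W \<inter> l2_ball M"
    by (simp add: W_def l2_ball_def l2_space_zero l2_inner_zero_left l2_norm_zero)
  have S_upper: "l2_norm M (T f) \<le> S" if "f \<in> W" "l2_norm M f \<le> 1" for f
    unfolding S_def using that W_l2[of f] by (intro cSup_upper bdd) (auto simp: V_def l2_ball_def)
  have S0: "0 \<le> S"
    using S_upper[of "\<lambda>x. 0"] zero_W l2_norm_nonneg[of M "T (\<lambda>x. 0)"] by (simp add: l2_ball_def)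
  have S_bound: "l2_norm M (T f) \<le> S * l2_norm M f" if f: "f \<in> W" for f
  proof (cases "l2_norm M f = 0")
    case True
    then show ?thesis using C(2)[OF W_l2[OF f]] by simp
  next
    case False
    have "1 / l2_norm M f * l2_norm M (T f) \<le> S"
      using S_upper[OF W_scale[OF f, of "1 / l2_norm M f"]] l2_normalize[OF W_l2[OF f] False]
        l2_operator_norm_scale[OF lin W_l2[OF f], of "1 / l2_norm M f"] l2_norm_nonneg[of M f]
      by simp
    then show ?thesis
      using False l2_norm_nonneg[of M f] by (simp add: field_simps)
  qed
  have attained: "\<exists>f\<in>W. l2_norm M f = 1 \<and> l2_norm M (T f) = S"
  proof (cases "S = 0")
    case True
    obtain f where "f \<in> l2_space M" "l2_norm M f = 1" "\<forall>i<n. l2_inner M f (w i) = 0"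
      using ex_unit_orthogonal[of n w] w by blast
    then have "f \<in> W" "l2_norm M f = 1" by (auto simp: W_def)
    moreover have "l2_norm M (T f) = 0"
      using S_bound[OF \<open>f \<in> W\<close>] True l2_norm_nonneg[of M "T f"] by simp
    ultimately show ?thesis using True by auto
  next
    case False
    with S0 have S: "S > 0" by simp
    have "\<exists>f\<in>W \<inter> l2_ball M. S - 1 / Suc k < l2_norm M (T f)" for k :: nat
    proof -
      have "S - 1 / Suc k < Sup V" by (simp add: S_def)
      then show ?thesis
        using less_cSup_iff[OF _ bdd] zero_W unfolding V_def by blast
    qed
    then obtain G where GW: "\<And>k. G k \<in> W" and Gball: "\<And>k. G k \<in> l2_ball M"
      and GS: "\<And>k. S - 1 / Suc k < l2_norm M (T (G k))"
      by (metis IntE)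
    have Gl2: "G k \<in> l2_space M" and G1: "l2_norm M (G k) \<le> 1" for k
      using Gball[of k] by (auto simp: l2_ball_def)
    obtain h \<sigma> where h: "h \<in> l2_space M" and \<sigma>: "strict_mono (\<sigma> :: nat \<Rightarrow> nat)"
      and lim: "(\<lambda>k. l2_norm M (\<lambda>x. T (G (\<sigma> k)) x - h x)) \<longlonglongrightarrow> 0"
      using T Gball unfolding l2_compact_operator_def by blast
    define F where "F k = G (\<sigma> k)" for k
    have F: "F k \<in> W" "F k \<in> l2_space M" "l2_norm M (F k) \<le> 1" for k
      by (simp_all add: F_def GW Gl2 G1)
    have TF: "T (F k) \<in> l2_space M" for k
      by (rule l2_operator_closed[OF lin F(2)])
    have TFS: "(\<lambda>k. l2_norm M (T (F k))) \<longlonglongrightarrow> S"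
    proof (rule tendsto_sandwich[of "\<lambda>k. S - 1 / Suc k" _ _ "\<lambda>k. S"])
      have "S - 1 / Suc k \<le> l2_norm M (T (F k))" for k
      proof -
        have "1 / real (Suc (\<sigma> k)) \<le> 1 / Suc k"
          using seq_suble[OF \<sigma>, of k] by (intro divide_left_mono) auto
        then show ?thesis using GS[of "\<sigma> k"] by (simp add: F_def)
      qed
      then show "\<forall>\<^sub>F k in sequentially. S - 1 / Suc k \<le> l2_norm M (T (F k))" by simp
      show "\<forall>\<^sub>F k in sequentially. l2_norm M (T (F k)) \<le> S"
        using S_upper[OF F(1) F(3)] by simp
      show "(\<lambda>k. S - 1 / Suc k) \<longlonglongrightarrow> S"
        using tendsto_diff[OF tendsto_const[of S] LIMSEQ_inverse_real_of_nat]
        by (simp add: inverse_eq_divide)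
    qed simp
    define d where "d k = l2_norm M (\<lambda>x. T (F k) x - h x)" for k
    \<comment> \<open>The parallelogram laws for $F_a \pm F_b$ and for $TF_a \pm TF_b$ together bound $\|F_a - F_b\|^2$ by $\epsilon_a + \epsilon_b$.\<close>
    define \<epsilon> where "\<epsilon> k = (2 * (S\<^sup>2 - (l2_norm M (T (F k)))\<^sup>2) + 2 * (d k)\<^sup>2) / S\<^sup>2" for k
    have \<epsilon>: "\<epsilon> \<longlonglongrightarrow> 0"
    proof -
      have "d \<longlonglongrightarrow> 0" using lim by (simp add: d_def[abs_def] F_def)
      then have "\<epsilon> \<longlonglongrightarrow> (2 * (S\<^sup>2 - S\<^sup>2) + 2 * 0\<^sup>2) / S\<^sup>2"
        unfolding \<epsilon>_def using S by (intro tendsto_intros TFS) auto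
      then show ?thesis by simp
    qed
    have cauchy: "(l2_norm M (\<lambda>x. F a x - F b x))\<^sup>2 \<le> \<epsilon> a + \<epsilon> b" for a b
    proof -
      define p q where "p = l2_norm M (\<lambda>x. F a x + F b x)"
        and "q = l2_norm M (T (\<lambda>x. F a x + F b x))"
      have par: "(l2_norm M (\<lambda>x. F a x - F b x))\<^sup>2
          = 2 * (l2_norm M (F a))\<^sup>2 + 2 * (l2_norm M (F b))\<^sup>2 - p\<^sup>2"
        by (simp add: p_def l2_norm_squared l2_inner_bilinear l2_space_closed F
            l2_inner_commute[of M "F b" "F a"])
      have parT: "q\<^sup>2 = 2 * (l2_norm M (T (F a)))\<^sup>2 + 2 * (l2_norm M (T (F b)))\<^sup>2
          - (l2_norm M (\<lambda>x. T (F a) x - T (F b) x))\<^sup>2"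
        using F l2_inner_commute[of M "T (F a)" "T (\<lambda>x. F a x + F b x)"]
          l2_inner_commute[of M "T (F b)" "T (\<lambda>x. F a x + F b x)"]
        by (simp add: q_def l2_norm_squared l2_inner_bilinear l2_space_closed lin TF
            l2_operator_inner_add l2_operator_closed[OF lin] l2_inner_commute[of M "T (F b)" "T (F a)"])
      have "q\<^sup>2 \<le> (S * p)\<^sup>2"
        unfolding p_def q_def
        by (intro power_mono S_bound W_add F) (simp add: l2_norm_nonneg)
      then have qp: "q\<^sup>2 / S\<^sup>2 \<le> p\<^sup>2"
        using S by (simp add: power_mult_distrib field_simps)
      have "(l2_norm M (\<lambda>x. T (F a) x - T (F b) x))\<^sup>2 \<le> (d a + d b)\<^sup>2"
        unfolding d_def by (intro power_mono l2_norm_triangle_via TF h l2_norm_nonneg)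
      also have "\<dots> \<le> 2 * (d a)\<^sup>2 + 2 * (d b)\<^sup>2"
        using sum_squares_bound[of "d a" "d b"] by (simp add: power2_sum)
      finally have "(2 * (l2_norm M (T (F a)))\<^sup>2 + 2 * (l2_norm M (T (F b)))\<^sup>2
          - 2 * (d a)\<^sup>2 - 2 * (d b)\<^sup>2) / S\<^sup>2 \<le> q\<^sup>2 / S\<^sup>2"
        unfolding parT by (intro divide_right_mono) auto
      moreover have "\<epsilon> a + \<epsilon> b = 4 - (2 * (l2_norm M (T (F a)))\<^sup>2 + 2 * (l2_norm M (T (F b)))\<^sup>2
          - 2 * (d a)\<^sup>2 - 2 * (d b)\<^sup>2) / S\<^sup>2"
        using S by (simp add: \<epsilon>_def field_simps)
      moreover have "(l2_norm M (F a))\<^sup>2 \<le> 1" "(l2_norm M (F b))\<^sup>2 \<le> 1"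
        using F(3) l2_norm_nonneg by (auto intro!: power_le_one)
      ultimately show ?thesis using par qp by linarith
    qed
    obtain f where f: "f \<in> l2_space M" and Ff: "(\<lambda>k. l2_norm M (\<lambda>x. F k x - f x)) \<longlonglongrightarrow> 0"
      using l2_complete[OF F(2) cauchy \<epsilon>] by blast
    have fW: "f \<in> W"
    proof -
      have "l2_inner M f (w i) = 0" if "i < n" for i
      proof (rule LIMSEQ_unique)
        show "(\<lambda>k. l2_inner M (F k) (w i)) \<longlonglongrightarrow> l2_inner M f (w i)"
          by (rule l2_inner_tendsto[OF F(2) f w[OF that] Ff])
        show "(\<lambda>k. l2_inner M (F k) (w i)) \<longlonglongrightarrow> 0"
          using F(1) that by (simp add: W_def)
      qed
      then show ?thesis using f by (simp add: W_def)
    qed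
    have f1: "l2_norm M f \<le> 1"
      by (rule LIMSEQ_le_const2[OF l2_norm_tendsto[OF F(2) f Ff]]) (use F(3) in blast)
    have "(\<lambda>k. l2_norm M (\<lambda>x. T (F k) x - T f x)) \<longlonglongrightarrow> 0"
    proof (rule Lim_null_comparison)
      show "(\<lambda>k. C * l2_norm M (\<lambda>x. F k x - f x)) \<longlonglongrightarrow> 0"
        using tendsto_mult_left[OF Ff] by simp
      show "\<forall>\<^sub>F k in sequentially. norm (l2_norm M (\<lambda>x. T (F k) x - T f x))
          \<le> C * l2_norm M (\<lambda>x. F k x - f x)"
        using C(2)[OF l2_space_diff[OF F(2) f]] l2_operator_norm_diff[OF lin F(2) f]
        by (simp add: l2_norm_nonneg)
    qed
    from l2_norm_tendsto[OF TF l2_operator_closed[OF lin f] this]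
    have Tf: "l2_norm M (T f) = S"
      using TFS LIMSEQ_unique by blast
    moreover have "S * 1 \<le> S * l2_norm M f"
      using S_bound[OF fW] Tf by simp
    then have "l2_norm M f = 1" using f1 S by simp
    ultimately show ?thesis using fW by blast
  qed
  then obtain f where "f \<in> W" "l2_norm M f = 1" "l2_norm M (T f) = S" by blast
  then show thesis
    using S_bound by (intro that[of f]) (auto simp: W_def)
qed

section \<open>The Schmidt expansion of a compact operator\<close>

text \<open>
  A Schmidt expansion is encoded by its right singular vectors alone. The last clause, the
  extremal property of $s_k$, takes the place of a completeness statement for $(f_k)$: with $s_k
  \to 0$ it makes the remainder of the expansion of $Tg$ tend to $0$.
\<close>

definition schmidt_system ::
    "'a measure \<Rightarrow> (('a \<Rightarrow> real) \<Rightarrow> 'a \<Rightarrow> real) \<Rightarrow> (nat \<Rightarrow> real) \<Rightarrow> (nat \<Rightarrow> 'a \<Rightarrow> real) \<Rightarrow> bool" where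
  "schmidt_system M T s f \<longleftrightarrow>
     l2_orthonormal M UNIV f \<and> (\<forall>k. s k = l2_norm M (T (f k))) \<and> decseq s \<and> s \<longlonglongrightarrow> 0 \<and>
     (\<forall>k. \<forall>g\<in>l2_space M. l2_inner M (T (f k)) (T g) = (s k)\<^sup>2 * l2_inner M (f k) g) \<and>
     (\<forall>k. \<forall>g\<in>l2_space M. (\<forall>i<k. l2_inner M g (f i) = 0) \<longrightarrow> l2_norm M (T g) \<le> s k * l2_norm M g)"

lemma schmidt_systemD:
  assumes "schmidt_system M T s f"
  shows "l2_orthonormal M UNIV f" "f k \<in> l2_space M"
    "l2_inner M (f i) (f j) = (if i = j then 1 else 0)"
    "s k = l2_norm M (T (f k))" "0 \<le> s k" "decseq s" "s \<longlonglongrightarrow> 0"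
    "g \<in> l2_space M \<Longrightarrow> l2_inner M (T (f k)) (T g) = (s k)\<^sup>2 * l2_inner M (f k) g"
    "g \<in> l2_space M \<Longrightarrow> (\<And>i. i < k \<Longrightarrow> l2_inner M g (f i) = 0) \<Longrightarrow>
      l2_norm M (T g) \<le> s k * l2_norm M g"
  using assms unfolding schmidt_system_def l2_orthonormal_def by (auto simp: l2_norm_nonneg)

lemma linear_coefficient_eq_0:
  fixes \<alpha> \<beta> :: real
  assumes "\<And>c. 2 * c * \<alpha> + c\<^sup>2 * \<beta> \<le> 0"
  shows "\<alpha> = 0"
proof -
  define D where "D = \<bar>\<beta>\<bar> + 1"
  have D: "D > 0" "2 * D + \<beta> > 0" by (auto simp: D_def)
  have "2 * (\<alpha> / D) * \<alpha> + (\<alpha> / D)\<^sup>2 * \<beta> = \<alpha>\<^sup>2 * (2 * D + \<beta>) / D\<^sup>2"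
    using D by (simp add: field_simps power2_eq_square)
  then have "\<alpha>\<^sup>2 * (2 * D + \<beta>) / D\<^sup>2 \<le> 0"
    using assms[of "\<alpha> / D"] by simp
  then have "\<alpha>\<^sup>2 * (2 * D + \<beta>) \<le> 0"
    using D by (simp add: divide_le_0_iff)
  then have "\<alpha>\<^sup>2 \<le> 0"
    using D by (simp add: mult_le_0_iff)
  then show ?thesis by simp
qed

text \<open>
  Iterated maximization. Each vector is chosen in the orthogonal complement of its predecessors,
  so orthonormality needs no correction afterwards.
\<close>

lemma (in infinite_dim_l2) ex_greedy_sequence:
  assumes T: "l2_compact_operator M T"
  obtains f where "l2_orthonormal M UNIV (f :: nat \<Rightarrow> 'a \<Rightarrow> real)"
    "\<And>k g. g \<in> l2_space M \<Longrightarrow> (\<And>i. i < k \<Longrightarrow> l2_inner M g (f i) = 0) \<Longrightarrow>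
      l2_norm M (T g) \<le> l2_norm M (T (f k)) * l2_norm M g"
proof -
  define P where "P f k r \<longleftrightarrow> r \<in> l2_space M \<and> l2_norm M r = 1 \<and> (\<forall>i<k. l2_inner M r (f i) = 0) \<and>
      (\<forall>g\<in>l2_space M. (\<forall>i<k. l2_inner M g (f i) = 0) \<longrightarrow>
        l2_norm M (T g) \<le> l2_norm M (T r) * l2_norm M g)"
    for f :: "nat \<Rightarrow> 'a \<Rightarrow> real" and k r
  have "\<exists>f. \<forall>k. P f k (f k)"
  proof (rule dependent_wellorder_choice)
    show "P f k r = P g k r" if "\<And>i. i < k \<Longrightarrow> f i = g i" for r f g k
      using that by (simp add: P_def)
    show "\<exists>r. P f k r" if "\<And>i. i < k \<Longrightarrow> P f i (f i)" for k f
    proof -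
      have "f i \<in> l2_space M" if "i < k" for i
        using \<open>\<And>i. i < k \<Longrightarrow> P f i (f i)\<close>[OF that] by (simp add: P_def)
      from this obtain r where "r \<in> l2_space M" "l2_norm M r = 1"
        "\<And>i. i < k \<Longrightarrow> l2_inner M r (f i) = 0"
        "\<And>g. g \<in> l2_space M \<Longrightarrow> (\<And>i. i < k \<Longrightarrow> l2_inner M g (f i) = 0) \<Longrightarrow>
          l2_norm M (T g) \<le> l2_norm M (T r) * l2_norm M g"
        by (rule compact_operator_maximizer[OF T, of k f]) blast+
      then show ?thesis
        unfolding P_def by blast
    qed
  qed
  then obtain f where f: "\<And>k. P f k (f k)" by blast
  show thesis
  proof
    have "l2_inner M (f j) (f i) = 0" if "i < j" for i j
      using f[of j] that by (simp add: P_def)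
    moreover from this have "l2_inner M (f i) (f j) = 0" if "i < j" for i j
      using that l2_inner_commute[of M "f i"] by simp
    moreover have "l2_inner M (f i) (f i) = 1" for i
      using f[of i] l2_norm_squared[of M "f i"] by (simp add: P_def)
    ultimately show "l2_orthonormal M UNIV f"
      using f unfolding l2_orthonormal_def P_def by (metis linorder_neqE_nat)
    show "l2_norm M (T g) \<le> l2_norm M (T (f k)) * l2_norm M g"
      if "g \<in> l2_space M" "\<And>i. i < k \<Longrightarrow> l2_inner M g (f i) = 0" for k g
      using f[of k] that by (simp add: P_def)
  qed
qed

text \<open>
  The first variation of $\|Tf\|^2 - \|Tf_k\|^2 \|f\|^2$ at its maximum point $f_k$ in $\{f_i : i
  < k\}^\perp$ gives the eigenvalue equation against test functions from this subspace. The
  remaining ones are combinations of the $f_i$ with $i < k$, and for these both sides vanish by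
  the equations for the $f_i$.
\<close>

lemma greedy_sequence_eigenfunction:
  assumes lin: "l2_linear_operator M T" and f: "l2_orthonormal M UNIV (f :: nat \<Rightarrow> 'a \<Rightarrow> real)"
    and max: "\<And>k g. g \<in> l2_space M \<Longrightarrow> (\<And>i. i < k \<Longrightarrow> l2_inner M g (f i) = 0) \<Longrightarrow>
      l2_norm M (T g) \<le> l2_norm M (T (f k)) * l2_norm M g"
    and g: "g \<in> l2_space M"
  shows "l2_inner M (T (f k)) (T g) = (l2_norm M (T (f k)))\<^sup>2 * l2_inner M (f k) g"
  using g
proof (induction k arbitrary: g rule: less_induct)
  case (less k)
  have fl2: "f i \<in> l2_space M" for i
    using f by (simp add: l2_orthonormal_def)
  have orth: "l2_inner M (f i) (f j) = (if i = j then 1 else 0)" for i j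
    using f by (simp add: l2_orthonormal_def)
  note closed = l2_operator_closed[OF lin]
  define S where "S = l2_norm M (T (f k))"
  have S2: "S\<^sup>2 = l2_inner M (T (f k)) (T (f k))"
    by (simp add: S_def l2_norm_squared)
  have variation: "l2_inner M (T (f k)) (T h) = S\<^sup>2 * l2_inner M (f k) h"
    if h: "h \<in> l2_space M" and h0: "\<And>i. i < k \<Longrightarrow> l2_inner M h (f i) = 0" for h
  proof -
    have "2 * c * (l2_inner M (T (f k)) (T h) - S\<^sup>2 * l2_inner M (f k) h)
        + c\<^sup>2 * (l2_inner M (T h) (T h) - S\<^sup>2 * l2_inner M h h) \<le> 0" for c
    proof -
      define p where "p = (\<lambda>x. f k x + c * h x)"
      have p: "p \<in> l2_space M"
        unfolding p_def by (intro l2_space_add l2_space_scale fl2 h)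
      have inner_p: "l2_inner M (T p) u = l2_inner M (T (f k)) u + c * l2_inner M (T h) u"
        if "u \<in> l2_space M" for u
        unfolding p_def using that h fl2
        by (simp add: l2_operator_inner_add[OF lin] l2_operator_inner_scale[OF lin] l2_space_scale)
      have "l2_inner M (T p) (T p) = l2_inner M (T (f k)) (T p) + c * l2_inner M (T h) (T p)"
        by (rule inner_p[OF closed[OF p]])
      also have "\<dots> = S\<^sup>2 + 2 * c * l2_inner M (T (f k)) (T h) + c\<^sup>2 * l2_inner M (T h) (T h)"
        using inner_p[OF closed[OF fl2[of k]]] inner_p[OF closed[OF h]]
        by (simp add: l2_inner_commute[of M "T (f k)" "T p"] l2_inner_commute[of M "T h" "T p"]
            l2_inner_commute[of M "T h" "T (f k)"] S2[unfolded power2_eq_square]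
            algebra_simps power2_eq_square)
      finally have Tp: "l2_inner M (T p) (T p)
          = S\<^sup>2 + 2 * c * l2_inner M (T (f k)) (T h) + c\<^sup>2 * l2_inner M (T h) (T h)" .
      have pp: "l2_inner M p p = 1 + 2 * c * l2_inner M (f k) h + c\<^sup>2 * l2_inner M h h"
        unfolding p_def using h fl2 orth[of k k]
        by (simp add: l2_inner_bilinear l2_space_closed l2_inner_commute[of M h "f k"]
            algebra_simps power2_eq_square)
      have "l2_inner M p (f i) = 0" if "i < k" for i
        unfolding p_def using that h fl2 orth[of k i] h0
        by (simp add: l2_inner_bilinear l2_space_closed)
      then have "(l2_norm M (T p))\<^sup>2 \<le> (S * l2_norm M p)\<^sup>2"
        unfolding S_def by (intro power_mono max p l2_norm_nonneg)
      then have "l2_inner M (T p) (T p) \<le> S\<^sup>2 * l2_inner M p p"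
        by (simp add: power_mult_distrib l2_norm_squared)
      then show ?thesis
        unfolding Tp pp by (simp add: algebra_simps)
    qed
    then have "l2_inner M (T (f k)) (T h) - S\<^sup>2 * l2_inner M (f k) h = 0"
      by (rule linear_coefficient_eq_0)
    then show ?thesis by simp
  qed
  define q where "q = (\<lambda>x. \<Sum>i<k. l2_inner M g (f i) * f i x)"
  have q: "q \<in> l2_space M"
    unfolding q_def by (intro l2_space_sum l2_space_scale fl2)
  have qf: "l2_inner M q (f i) = (if i < k then l2_inner M g (f i) else 0)" for i
    unfolding q_def using l2_orthonormal_inner_combination[OF f finite_lessThan[of k] subset_UNIV UNIV_I]
    by simp
  have "l2_inner M (T q) (T (f k)) = (\<Sum>i<k. l2_inner M g (f i) * l2_inner M (T (f i)) (T (f k)))"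
    unfolding q_def using fl2 closed by (intro l2_operator_inner_sum[OF lin]) auto
  also have "\<dots> = 0"
    using less.IH fl2 orth by (intro sum.neutral) simp
  finally have Tq: "l2_inner M (T q) (T (f k)) = 0" .
  have "l2_inner M (T (f k)) (T (\<lambda>x. g x - q x)) = S\<^sup>2 * l2_inner M (f k) (\<lambda>x. g x - q x)"
    using less.prems q qf fl2
    by (intro variation) (auto simp: l2_space_diff l2_inner_diff_left)
  moreover have "l2_inner M (T (\<lambda>x. g x - q x)) (T (f k))
      = l2_inner M (T g) (T (f k)) - l2_inner M (T q) (T (f k))"
    by (rule l2_operator_inner_diff[OF lin less.prems q closed[OF fl2]])
  moreover have "l2_inner M (\<lambda>x. g x - q x) (f k) = l2_inner M g (f k)"
    using less.prems q qf[of k] fl2 by (simp add: l2_inner_diff_left)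
  ultimately show ?case
    using Tq by (simp add: S_def l2_inner_commute[of M "f k"] l2_inner_commute[of M "T (f k)"])
qed

text \<open>
  What remains is that $s_k \to 0$. The $Tf_k$ are orthogonal, so if their norms stayed above some
  $L > 0$, their mutual distances would be at least $L$, and no subsequence could converge.
\<close>

theorem (in infinite_dim_l2) ex_schmidt_system:
  assumes T: "l2_compact_operator M T"
  shows "\<exists>s f. schmidt_system M T s f"
proof -
  note lin = l2_compact_operator_linear[OF T]
  note closed = l2_operator_closed[OF lin]
  obtain f :: "nat \<Rightarrow> 'a \<Rightarrow> real" where f: "l2_orthonormal M UNIV f"
    and max: "\<And>k g. g \<in> l2_space M \<Longrightarrow> (\<And>i. i < k \<Longrightarrow> l2_inner M g (f i) = 0) \<Longrightarrow>
      l2_norm M (T g) \<le> l2_norm M (T (f k)) * l2_norm M g"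
    using ex_greedy_sequence[OF T] by blast
  have fl2: "f i \<in> l2_space M" for i
    using f by (simp add: l2_orthonormal_def)
  have orth: "l2_inner M (f i) (f j) = (if i = j then 1 else 0)" for i j
    using f by (simp add: l2_orthonormal_def)
  have f1: "l2_norm M (f i) = 1" for i
    by (simp add: l2_norm_def orth)
  define s where "s k = l2_norm M (T (f k))" for k
  have s0: "0 \<le> s k" for k by (simp add: s_def l2_norm_nonneg)
  have eig: "l2_inner M (T (f k)) (T g) = (s k)\<^sup>2 * l2_inner M (f k) g" if "g \<in> l2_space M" for k g
    unfolding s_def by (rule greedy_sequence_eigenfunction[OF lin f max that])
  have dec: "decseq s"
  proof (rule decseq_SucI)
    show "s (Suc n) \<le> s n" for n
      using max[of "f (Suc n)" n] fl2 orth f1 by (simp add: s_def)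
  qed
  obtain L where L: "s \<longlonglongrightarrow> L" "\<And>k. L \<le> s k"
    using decseq_convergent[OF dec, of 0] s0 by blast
  have "L = 0"
  proof (rule ccontr)
    assume "L \<noteq> 0"
    moreover have "0 \<le> L" by (rule LIMSEQ_le_const[OF L(1)]) (use s0 in blast)
    ultimately have L0: "L > 0" by simp
    have "f k \<in> l2_ball M" for k by (simp add: l2_ball_def fl2 f1)
    then obtain h \<sigma> where h: "h \<in> l2_space M" and \<sigma>: "strict_mono (\<sigma> :: nat \<Rightarrow> nat)"
      and lim: "(\<lambda>k. l2_norm M (\<lambda>x. T (f (\<sigma> k)) x - h x)) \<longlonglongrightarrow> 0"
      using T unfolding l2_compact_operator_def by blast
    define d where "d k = l2_norm M (\<lambda>x. T (f (\<sigma> k)) x - h x)" for k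
    have "(\<lambda>k. d k + d (Suc k)) \<longlonglongrightarrow> 0 + 0"
      using lim LIMSEQ_Suc[OF lim] unfolding d_def by (intro tendsto_add)
    moreover have "L \<le> d k + d (Suc k)" for k
    proof -
      have ne: "\<sigma> k \<noteq> \<sigma> (Suc k)"
        using strict_monoD[OF \<sigma>, of k "Suc k"] by simp
      have "(l2_norm M (\<lambda>x. T (f (\<sigma> k)) x - T (f (\<sigma> (Suc k))) x))\<^sup>2
          = (s (\<sigma> k))\<^sup>2 + (s (\<sigma> (Suc k)))\<^sup>2"
        unfolding l2_norm_squared
        using ne by (simp add: l2_inner_bilinear l2_space_closed closed fl2 eig orth)
      moreover have "L\<^sup>2 \<le> (s (\<sigma> k))\<^sup>2"
        using L(2) L0 by (intro power_mono) auto
      ultimately have "L\<^sup>2 \<le> (l2_norm M (\<lambda>x. T (f (\<sigma> k)) x - T (f (\<sigma> (Suc k))) x))\<^sup>2"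
        by (simp add: add_increasing2)
      then have "L \<le> l2_norm M (\<lambda>x. T (f (\<sigma> k)) x - T (f (\<sigma> (Suc k))) x)"
        by (rule power2_le_imp_le[OF _ l2_norm_nonneg])
      also have "\<dots> \<le> d k + d (Suc k)"
        unfolding d_def by (intro l2_norm_triangle_via closed fl2 h)
      finally show ?thesis .
    qed
    ultimately have "L \<le> 0 + 0" by (intro LIMSEQ_le_const) auto
    with L0 show False by simp
  qed
  with L(1) have "s \<longlonglongrightarrow> 0" by simp
  then have "schmidt_system M T s f"
    unfolding schmidt_system_def using f dec eig max by (simp add: s_def)
  then show ?thesis by blast
qed

text \<open>
  Both dimensions equal $\sum_{i,j} (e_i, e'_j)^2$, by Parseval's identity for either basis.
\<close>

lemma l2_has_dim_unique:
  assumes "l2_has_dim M E n" "l2_has_dim M E n'" and E: "E \<subseteq> l2_space M"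
  shows "n = n'"
proof -
  obtain e where e: "l2_orthonormal M {..<n} e" "\<forall>i<n. e i \<in> E"
    "\<forall>f\<in>E. AE x in M. f x = (\<Sum>i<n. l2_inner M f (e i) * e i x)"
    using assms(1) unfolding l2_has_dim_def by blast
  obtain e' where e': "l2_orthonormal M {..<n'} e'" "\<forall>i<n'. e' i \<in> E"
    "\<forall>f\<in>E. AE x in M. f x = (\<Sum>i<n'. l2_inner M f (e' i) * e' i x)"
    using assms(2) unfolding l2_has_dim_def by blast
  have parseval: "l2_inner M f f = (\<Sum>i<n. (l2_inner M f (e i))\<^sup>2)"
    if f: "f \<in> E" and e: "\<forall>i<n. e i \<in> E"
      "AE x in M. f x = (\<Sum>i<n. l2_inner M f (e i) * e i x)" for f n and e :: "nat \<Rightarrow> 'a \<Rightarrow> real"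
  proof -
    have "l2_inner M f f = l2_inner M (\<lambda>x. \<Sum>i<n. l2_inner M f (e i) * e i x) f"
      using f e E by (intro l2_inner_cong_AE) (auto intro!: l2_space_sum l2_space_scale)
    also have "\<dots> = (\<Sum>i<n. l2_inner M f (e i) * l2_inner M (e i) f)"
      using f e E by (subst l2_inner_sum_left) (auto simp: l2_inner_scale_left intro!: l2_space_scale)
    finally show ?thesis by (simp add: power2_eq_square l2_inner_commute)
  qed
  have "real n = (\<Sum>i<n. l2_inner M (e i) (e i))"
    using e(1) by (simp add: l2_orthonormal_def)
  also have "\<dots> = (\<Sum>i<n. \<Sum>j<n'. (l2_inner M (e i) (e' j))\<^sup>2)"
    using e e' by (intro sum.cong parseval) auto
  also have "\<dots> = (\<Sum>j<n'. \<Sum>i<n. (l2_inner M (e' j) (e i))\<^sup>2)"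
    by (subst sum.swap) (simp add: l2_inner_commute)
  also have "\<dots> = (\<Sum>j<n'. l2_inner M (e' j) (e' j))"
    using e e' by (intro sum.cong parseval[symmetric]) auto
  also have "\<dots> = real n'"
    using e'(1) by (simp add: l2_orthonormal_def)
  finally show ?thesis by simp
qed

text \<open>
  Suppose that two sequences agree below \<open>n\<close> and that the first is larger at
  \<open>n\<close>. By monotonicity the second takes the value $\mu$ of the first at
  \<open>n\<close> only at indices below \<open>n\<close>, hence less often than the first does,
  whereas both must take it as often as the dimension of the eigenspace.
\<close>

lemma singular_sequence_unique:
  assumes s: "singular_sequence M T s" and t: "singular_sequence M T t"
  shows "s = t"
proof -
  have card_eq: "card {k. s k = \<mu>} = card {k. t k = \<mu>}" if "\<mu> > 0" for \<mu>
    using s t that unfolding singular_sequence_def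
    by (intro l2_has_dim_unique[of M "l2_eigenspace_TstarT M T (\<mu>\<^sup>2)"])
      (auto simp: l2_eigenspace_TstarT_def)
  have le: "u n \<le> v n"
    if u: "singular_sequence M T u" and v: "singular_sequence M T v"
      and eq: "\<And>\<mu>. \<mu> > 0 \<Longrightarrow> card {k. u k = \<mu>} = card {k. v k = \<mu>}"
      and IH: "\<And>i. i < n \<Longrightarrow> u i = v i" for u v n
  proof (rule ccontr)
    assume "\<not> u n \<le> v n"
    then have gt: "v n < u n" by simp
    have "0 \<le> v n" "decseq v" using v by (auto simp: singular_sequence_def)
    with gt have pos: "u n > 0" by simp
    have "{k. v k = u n} \<subset> {k. u k = u n}"
    proof
      show "{k. v k = u n} \<subseteq> {k. u k = u n}"
      proof
        fix k assume k: "k \<in> {k. v k = u n}"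
        then have "k < n"
          using decseqD[OF \<open>decseq v\<close>, of n k] gt by (cases "n \<le> k") auto
        then show "k \<in> {k. u k = u n}" using IH k by simp
      qed
      show "{k. v k = u n} \<noteq> {k. u k = u n}"
        using gt by (metis (mono_tags) mem_Collect_eq less_irrefl)
    qed
    moreover have "finite {k. u k = u n}" using u pos by (simp add: singular_sequence_def)
    ultimately have "card {k. v k = u n} < card {k. u k = u n}" by (rule psubset_card_mono[rotated])
    then show False using eq[OF pos] by simp
  qed
  have "s n = t n" for n
  proof (induction n rule: less_induct)
    case (less n)
    show ?case
      by (rule antisym[OF le[OF s t card_eq less.IH] le[OF t s card_eq[symmetric] less.IH[symmetric]]])
  qed
  then show ?thesis by blast
qed

text \<open>
  The $f_k$ with $s_k = \mu$ span the eigenspace for $\mu^2$: what is left of an eigenfunction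
  after subtracting its components along them is orthogonal to all $f_k$, hence is annihilated by
  $T$, and then the eigenvalue equation makes it zero.
\<close>

lemma schmidt_system_singular_sequence:
  assumes lin: "l2_linear_operator M T" and S: "schmidt_system M T s f"
  shows "singular_sequence M T s"
  unfolding singular_sequence_def
proof (intro conjI allI impI)
  show "decseq s" "0 \<le> s k" for k
    using schmidt_systemD[OF S] by blast+
  note fl2 = schmidt_systemD(2)[OF S] and eig = schmidt_systemD(8)[OF S]
  note closed = l2_operator_closed[OF lin]
  fix \<mu> :: real assume \<mu>: "\<mu> > 0"
  define K where "K = {k. s k = \<mu>}"
  have "\<forall>\<^sub>F k in sequentially. s k < \<mu>"
    using order_tendstoD(2)[OF schmidt_systemD(7)[OF S] \<mu>] .
  then obtain N where N: "\<And>k. k \<ge> N \<Longrightarrow> s k < \<mu>" by (auto simp: eventually_sequentially)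
  have "k < N" if "k \<in> K" for k
    using N[of k] that by (cases "k < N") (auto simp: K_def)
  then have "K \<subseteq> {..<N}" by blast
  then have K: "finite K" by (rule finite_subset) simp
  then show "finite {k. s k = \<mu>}" by (simp add: K_def)
  obtain h where h: "bij_betw h {..<card K} K"
    using ex_bij_betw_nat_finite[OF K] by (auto simp: atLeast0LessThan)
  have "l2_has_dim M (l2_eigenspace_TstarT M T (\<mu>\<^sup>2)) (card K)"
    unfolding l2_has_dim_def
  proof (intro exI[of _ "\<lambda>i. f (h i)"] conjI ballI allI impI)
    show "l2_orthonormal M {..<card K} (\<lambda>i. f (h i))"
      using h schmidt_systemD(2,3)[OF S] unfolding l2_orthonormal_def
      by (auto simp: bij_betw_def inj_on_eq_iff)
    show "f (h i) \<in> l2_eigenspace_TstarT M T (\<mu>\<^sup>2)" if "i < card K" for i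
    proof -
      have "s (h i) = \<mu>" using h that by (auto simp: bij_betw_def K_def)
      then show ?thesis by (auto simp: l2_eigenspace_TstarT_def fl2 eig)
    qed
    fix g assume "g \<in> l2_eigenspace_TstarT M T (\<mu>\<^sup>2)"
    then have g: "g \<in> l2_space M"
      and geig: "\<And>v. v \<in> l2_space M \<Longrightarrow> l2_inner M (T g) (T v) = \<mu>\<^sup>2 * l2_inner M g v"
      by (auto simp: l2_eigenspace_TstarT_def)
    define q where "q = (\<lambda>x. \<Sum>k\<in>K. l2_inner M g (f k) * f k x)"
    have q: "q \<in> l2_space M"
      unfolding q_def by (intro l2_space_sum l2_space_scale fl2)
    define p where "p = (\<lambda>x. g x - q x)"
    have p: "p \<in> l2_space M"
      unfolding p_def by (intro l2_space_diff g q)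
    have peig: "l2_inner M (T p) (T v) = \<mu>\<^sup>2 * l2_inner M p v" if v: "v \<in> l2_space M" for v
    proof -
      have "l2_inner M (T q) (T v) = (\<Sum>k\<in>K. l2_inner M g (f k) * l2_inner M (T (f k)) (T v))"
        unfolding q_def by (rule l2_operator_inner_sum[OF lin fl2 closed[OF v]])
      also have "\<dots> = (\<Sum>k\<in>K. \<mu>\<^sup>2 * l2_inner M (\<lambda>x. l2_inner M g (f k) * f k x) v)"
        by (intro sum.cong) (auto simp: eig v K_def l2_inner_scale_left)
      also have "\<dots> = \<mu>\<^sup>2 * l2_inner M q v"
        unfolding q_def by (subst l2_inner_sum_left) (auto simp: sum_distrib_left v fl2 l2_space_scale)
      finally show ?thesis
        unfolding p_def using geig[OF v] l2_operator_inner_diff[OF lin g q closed[OF v]]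
        by (simp add: l2_inner_diff_left g q v right_diff_distrib)
    qed
    have pf: "l2_inner M p (f j) = 0" for j
    proof (cases "j \<in> K")
      case True
      have "l2_inner M q (f j) = l2_inner M g (f j)"
        unfolding q_def using True
          l2_orthonormal_inner_combination[OF schmidt_systemD(1)[OF S] K subset_UNIV UNIV_I] by simp
      then show ?thesis unfolding p_def by (simp add: l2_inner_diff_left g q fl2)
    next
      case False
      then have ne: "(s j)\<^sup>2 \<noteq> \<mu>\<^sup>2"
        using \<mu> schmidt_systemD(5)[OF S, of j] by (simp add: K_def power2_eq_iff_nonneg)
      have "\<mu>\<^sup>2 * l2_inner M p (f j) = (s j)\<^sup>2 * l2_inner M p (f j)"
        using peig[OF fl2[of j]] eig[OF p, of j]
        by (simp add: l2_inner_commute[of M "f j"] l2_inner_commute[of M "T (f j)"])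
      then show ?thesis using ne by simp
    qed
    have "l2_norm M (T p) \<le> 0"
    proof (rule LIMSEQ_le_const)
      show "(\<lambda>k. s k * l2_norm M p) \<longlonglongrightarrow> 0"
        using tendsto_mult_right[OF schmidt_systemD(7)[OF S], of "l2_norm M p"] by simp
      show "\<exists>N. \<forall>k\<ge>N. l2_norm M (T p) \<le> s k * l2_norm M p"
        using schmidt_systemD(9)[OF S p] pf by blast
    qed
    then have "l2_inner M (T p) (T p) = 0"
      using l2_norm_squared[of M "T p"] l2_norm_nonneg[of M "T p"] by simp
    then have "l2_norm M p = 0"
      using peig[OF p] \<mu> by (simp add: l2_norm_def)
    then have "AE x in M. p x = 0"
      using l2_norm_eq_0_iff[OF p] by simp
    then show "AE x in M. g x = (\<Sum>i<card K. l2_inner M g (f (h i)) * f (h i) x)"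
    proof eventually_elim
      case (elim x)
      then show ?case
        using sum.reindex_bij_betw[OF h, of "\<lambda>k. l2_inner M g (f k) * f k x"]
        by (simp add: p_def q_def)
    qed
  qed
  then show "l2_has_dim M (l2_eigenspace_TstarT M T (\<mu>\<^sup>2)) (card {k. s k = \<mu>})"
    by (simp add: K_def)
qed

theorem (in infinite_dim_l2) schmidt_system_singular_number:
  assumes T: "l2_compact_operator M T"
  obtains f where "schmidt_system M T (singular_number M T) f"
proof -
  obtain s f where S: "schmidt_system M T s f"
    using ex_schmidt_system[OF T] by blast
  have "singular_sequence M T s"
    by (rule schmidt_system_singular_sequence[OF l2_compact_operator_linear[OF T] S])
  then have "singular_number M T = s"
    unfolding singular_number_def using singular_sequence_unique by (intro the_equality) auto
  with S show thesis using that by simp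
qed

section \<open>Measures without point masses\<close>

text \<open>
  With more orthonormal vectors than conditions, some nonzero combination satisfies all of them.
\<close>

lemma (in prob_space) infinite_dim_l2I:
  assumes "\<And>n. \<exists>(J :: nat set) e. finite J \<and> n < card J \<and> l2_orthonormal M J e"
  shows "infinite_dim_l2 M"
proof unfold_locales
  fix n and w :: "nat \<Rightarrow> 'a \<Rightarrow> real"
  assume w: "\<And>i. i < n \<Longrightarrow> w i \<in> l2_space M"
  obtain J :: "nat set" and e where J: "finite J" "n < card J" and e: "l2_orthonormal M J e"
    using assms[of n] by blast
  have el2: "j \<in> J \<Longrightarrow> e j \<in> l2_space M" for j
    using e by (simp add: l2_orthonormal_def)
  obtain c j where j: "j \<in> J" "c j \<noteq> 0"
    and c: "\<And>i. i < n \<Longrightarrow> (\<Sum>j\<in>J. l2_inner M (e j) (w i) * c j) = 0"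
    using homogeneous_system_nontrivial_solution[OF J, of "\<lambda>i j. l2_inner M (e j) (w i)"] by blast
  define f where "f = (\<lambda>x. \<Sum>j\<in>J. c j * e j x)"
  have f: "f \<in> l2_space M"
    unfolding f_def by (intro l2_space_sum l2_space_scale el2)
  have fw: "l2_inner M f (w i) = 0" if "i < n" for i
    unfolding f_def using c[OF that] w[OF that] el2
    by (subst l2_inner_sum_left) (auto simp: l2_inner_scale_left l2_space_scale mult.commute)
  have "0 < (\<Sum>j\<in>J. (c j)\<^sup>2)"
    using J(1) j by (intro sum_pos2[of _ j]) auto
  then have "l2_norm M f \<noteq> 0"
    unfolding f_def l2_norm_def l2_orthonormal_combination_norm[OF e J(1)] by simp
  from l2_normalize[OF f this] fw
  show "\<exists>f\<in>l2_space M. l2_norm M f = 1 \<and> (\<forall>i<n. l2_inner M f (w i) = 0)"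
    by (intro bexI[of _ "\<lambda>x. 1 / l2_norm M f * f x"]) (simp_all only: l2_inner_scale_left, simp)
qed

text \<open>
  The balls around \<open>x\<close> shrink to the null set \<open>{x}\<close>.
\<close>

lemma small_open_neighbourhood:
  fixes x :: "'a::metric_space"
  assumes "finite_measure M" and borel: "sets M = sets borel" and "emeasure M {x} = 0" and "0 < \<epsilon>"
  shows "\<exists>U. open U \<and> x \<in> U \<and> measure M U < \<epsilon>"
proof -
  interpret finite_measure M by fact
  define A where "A n = ball x (1 / Suc n)" for n
  have "range A \<subseteq> sets M" by (auto simp: A_def borel)
  moreover have "decseq A"
    unfolding A_def decseq_def by (intro allI impI subset_ball) (simp add: frac_le)
  ultimately have "(\<lambda>n. measure M (A n)) \<longlonglongrightarrow> measure M (\<Inter>n. A n)"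
    by (rule finite_Lim_measure_decseq)
  also have "(\<Inter>n. A n) = {x}"
  proof (intro equalityI subsetI)
    fix y assume "y \<in> (\<Inter>n. A n)"
    then have "dist x y < 1 / Suc n" for n by (auto simp: A_def)
    then have "\<not> 0 < dist x y"
      using nat_approx_posE[of "dist x y"] less_asym by metis
    then show "y \<in> {x}" by simp
  qed (auto simp: A_def)
  also have "measure M {x} = 0" using \<open>emeasure M {x} = 0\<close> by (simp add: measure_def)
  finally obtain n where "measure M (A n) < \<epsilon>"
    using order_tendstoD(2)[OF _ \<open>0 < \<epsilon>\<close>] eventually_sequentially by (metis order_refl)
  then show ?thesis by (intro exI[of _ "A n"]) (simp add: A_def)
qed

lemma (in prob_space) orthonormal_indicators:
  assumes A: "\<And>j. j \<in> J \<Longrightarrow> A j \<in> sets M" "disjoint_family_on A J"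
    and pos: "\<And>j. j \<in> J \<Longrightarrow> 0 < measure M (A j)"
  shows "l2_orthonormal M J (\<lambda>j x. 1 / sqrt (measure M (A j)) * indicat_real (A j) x)"
  unfolding l2_orthonormal_def
proof (intro conjI ballI)
  show "(\<lambda>x. 1 / sqrt (measure M (A j)) * indicat_real (A j) x) \<in> l2_space M" if "j \<in> J" for j
  proof (rule l2_space_scale)
    have "(\<lambda>x. (indicat_real (A j) x)\<^sup>2) = indicat_real (A j)"
      by (auto simp: indicator_def)
    then show "indicat_real (A j) \<in> l2_space M"
      using A(1)[OF that] by (simp add: l2_space_def emeasure_eq_measure)
  qed
  fix i j assume ij: "i \<in> J" "j \<in> J"
  have "l2_inner M (indicat_real (A i)) (indicat_real (A j)) = (if i = j then measure M (A i) else 0)"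
  proof -
    have "A i \<inter> A j = {}" if "i \<noteq> j"
      using A(2) ij that by (auto simp: disjoint_family_on_def)
    moreover have "l2_inner M (indicat_real (A i)) (indicat_real (A j)) = measure M (A i \<inter> A j)"
      using A(1) ij by (simp add: l2_inner_def flip: indicator_inter_arith)
    ultimately show ?thesis by simp
  qed
  then show "l2_inner M (\<lambda>x. 1 / sqrt (measure M (A i)) * indicat_real (A i) x)
      (\<lambda>x. 1 / sqrt (measure M (A j)) * indicat_real (A j) x) = (if i = j then 1 else 0)"
    using pos[OF ij(1)] pos[OF ij(2)] by (simp only: l2_inner_scale_left l2_inner_scale_right) simp
qed

text \<open>
  By compactness the space is a finite disjoint union of sets of measure at most $1/(n+1)$. More
  than $n$ of them must have positive measure, and their normalized indicators are orthonormal.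
\<close>

lemma no_point_masses_infinite_dim_l2:
  fixes M :: "'a::metric_space measure"
  assumes compact: "compact (UNIV :: 'a set)" and borel: "sets M = sets borel"
    and "prob_space M" and points: "\<And>x. emeasure M {x} = 0"
  shows "infinite_dim_l2 M"
proof -
  interpret prob_space M by fact
  have space: "space M = UNIV"
    using sets_eq_imp_space_eq[OF borel] by simp
  show ?thesis
  proof (rule infinite_dim_l2I)
    fix n :: nat
    define C where "C = {U. open U \<and> measure M U < 1 / Suc n}"
    have "UNIV \<subseteq> \<Union>C"
      using small_open_neighbourhood[OF finite_measure_axioms borel points, of "1 / Suc n"] by (auto simp: C_def)
    with compact obtain D where D: "D \<subseteq> C" "finite D" "UNIV \<subseteq> \<Union>D"
      by (rule compactE) (auto simp: C_def)
    obtain p and B :: "nat \<Rightarrow> 'a set" where B: "D = B ` {i. i < p}"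
      using finite_imp_nat_seg_image_inj_on[OF D(2)] by blast
    have BC: "open (B i)" "measure M (B i) < 1 / Suc n" if "i < p" for i
      using D(1) that by (auto simp: B C_def)
    define A where "A i = B i - (\<Union>j<i. B j)" for i
    have A: "A i \<in> sets M" if "i < p" for i
      using BC(1) that unfolding A_def borel
      by (intro sets.Diff sets.finite_UN borel_open) auto
    have A_disj: "disjoint_family_on A {..<p}"
      unfolding disjoint_family_on_def A_def by (auto simp: neq_iff)
    have "(\<Union>i<p. A i) = UNIV"
    proof -
      have "\<exists>i<p. x \<in> A i" for x
      proof -
        have ex: "\<exists>i. i < p \<and> x \<in> B i" using D(3) by (auto simp: B)
        define i where "i = (LEAST i. i < p \<and> x \<in> B i)"
        have "i < p \<and> x \<in> B i" unfolding i_def by (rule LeastI_ex[OF ex])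
        moreover from this have "x \<notin> B j" if "j < i" for j
          using not_less_Least[of j "\<lambda>i. i < p \<and> x \<in> B i"] that by (auto simp: i_def[symmetric])
        ultimately show ?thesis by (auto simp: A_def)
      qed
      then show ?thesis by auto
    qed
    then have "1 = measure M (\<Union>i<p. A i)"
      using prob_space by (simp add: space)
    also have "\<dots> = (\<Sum>i<p. measure M (A i))"
      using A A_disj by (intro finite_measure_finite_Union) auto
    also have "\<dots> = (\<Sum>i\<in>{i. i < p \<and> 0 < measure M (A i)}. measure M (A i))"
      using zero_less_measure_iff by (intro sum.mono_neutral_right) auto
    also have "\<dots> \<le> (\<Sum>i\<in>{i. i < p \<and> 0 < measure M (A i)}. 1 / Suc n)"
    proof (rule sum_mono)
      fix i assume i: "i \<in> {i. i < p \<and> 0 < measure M (A i)}"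
      have "measure M (A i) \<le> measure M (B i)"
        using i BC(1) by (intro finite_measure_mono) (auto simp: A_def borel)
      then show "measure M (A i) \<le> 1 / Suc n" using BC(2)[of i] i by simp
    qed
    finally have "n < card {i. i < p \<and> 0 < measure M (A i)}"
      by (simp add: field_simps)
    moreover have "l2_orthonormal M {i. i < p \<and> 0 < measure M (A i)}
        (\<lambda>j x. 1 / sqrt (measure M (A j)) * indicat_real (A j) x)"
      using A A_disj by (intro orthonormal_indicators) (auto simp: disjoint_family_on_def)
    ultimately show "\<exists>(J :: nat set) e. finite J \<and> n < card J \<and> l2_orthonormal M J e"
      by (intro exI[of _ "{i. i < p \<and> 0 < measure M (A i)}"] exI conjI) auto
  qed
qed

section \<open>Projection to the zero-mean subspace\<close>

context prob_space
begin

lemma integral_eq_l2_inner_const: "(\<integral>x. f x \<partial>M) = l2_inner M f (\<lambda>x. 1)"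
  by (simp add: l2_inner_def)

lemma l2_center_closed: "f \<in> l2_space M \<Longrightarrow> l2_center M f \<in> l2_space M"
  unfolding l2_center_def by (intro l2_space_diff l2_space_const)

lemma l2_center_zero_mean:
  assumes "f \<in> l2_space M"
  shows "l2_center M f \<in> l2_zero_mean M"
  using assms l2_center_closed[OF assms] l2_space_integrable[OF assms]
  by (simp add: l2_zero_mean_def) (simp add: l2_center_def prob_space)

lemma l2_zero_mean_closed: "u \<in> l2_zero_mean M \<Longrightarrow> u \<in> l2_space M"
  by (simp add: l2_zero_mean_def)

lemma l2_inner_center:
  assumes "u \<in> l2_zero_mean M" "f \<in> l2_space M"
  shows "l2_inner M (l2_center M f) u = l2_inner M f u"
proof -
  have "l2_inner M (l2_center M f) u = l2_inner M f u - (\<integral>y. f y \<partial>M) * (\<integral>y. u y \<partial>M)"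
    unfolding l2_center_def using assms l2_space_const
    by (subst l2_inner_diff_left) (auto simp: l2_zero_mean_closed, simp add: l2_inner_def)
  then show ?thesis using assms(1) by (simp add: l2_zero_mean_def)
qed

lemma l2_norm_center_le:
  assumes f: "f \<in> l2_space M"
  shows "l2_norm M (l2_center M f) \<le> l2_norm M f"
proof -
  have "(l2_norm M (l2_center M f))\<^sup>2 = l2_inner M f (l2_center M f)"
    unfolding l2_norm_squared by (rule l2_inner_center[OF l2_center_zero_mean[OF f] f])
  also have "\<dots> \<le> l2_norm M f * l2_norm M (l2_center M f)"
    using l2_cauchy_schwarz[OF f l2_center_closed[OF f]] by simp
  finally show ?thesis
    using l2_norm_nonneg[of M f] l2_norm_nonneg[of M "l2_center M f"]
    by (cases "l2_norm M (l2_center M f) = 0") (auto simp: power2_eq_square)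
qed

lemma l2_center_linear_operator:
  assumes T: "l2_linear_operator M T"
  shows "l2_linear_operator M (l2_center M \<circ> T)"
proof -
  note closed = l2_operator_closed[OF T]
  have mean: "(\<integral>x. u x \<partial>M) = (\<integral>x. v x \<partial>M)"
    if "u \<in> l2_space M" "v \<in> l2_space M" "AE x in M. u x = v x" for u v
    using that by (intro integral_cong_AE l2_space_measurable)
  show ?thesis
    unfolding l2_linear_operator_def comp_def
  proof (intro conjI ballI allI impI)
    show "l2_center M (T f) \<in> l2_space M" if "f \<in> l2_space M" for f
      by (rule l2_center_closed[OF closed[OF that]])
  next
    fix f g assume fg: "f \<in> l2_space M" "g \<in> l2_space M" "AE x in M. f x = g x"
    then have ae: "AE x in M. T f x = T g x"
      using T by (simp add: l2_linear_operator_def)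
    show "AE x in M. l2_center M (T f) x = l2_center M (T g) x"
      using ae mean[OF closed closed ae] fg by (simp add: l2_center_def)
  next
    fix f g assume fg: "f \<in> l2_space M" "g \<in> l2_space M"
    then have ae: "AE x in M. T (\<lambda>y. f y + g y) x = T f x + T g x"
      using T by (simp add: l2_linear_operator_def)
    have "(\<integral>x. T (\<lambda>y. f y + g y) x \<partial>M) = (\<integral>x. T f x + T g x \<partial>M)"
      by (rule mean[OF _ _ ae]) (intro closed l2_space_add fg)+
    then have "(\<integral>x. T (\<lambda>y. f y + g y) x \<partial>M) = (\<integral>x. T f x \<partial>M) + (\<integral>x. T g x \<partial>M)"
      using fg by (simp add: l2_space_integrable closed)
    with ae show "AE x in M. l2_center M (T (\<lambda>y. f y + g y)) x
        = l2_center M (T f) x + l2_center M (T g) x"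
      by (simp add: l2_center_def)
  next
    fix c f assume f: "f \<in> l2_space M"
    then have ae: "AE x in M. T (\<lambda>y. c * f y) x = c * T f x"
      using T by (simp add: l2_linear_operator_def)
    have "(\<integral>x. T (\<lambda>y. c * f y) x \<partial>M) = (\<integral>x. c * T f x \<partial>M)"
      using f by (intro mean[OF _ _ ae]) (auto intro: closed l2_space_scale)
    with ae show "AE x in M. l2_center M (T (\<lambda>y. c * f y)) x = c * l2_center M (T f) x"
      by (simp add: l2_center_def right_diff_distrib)
  qed
qed

lemma l2_center_compact_operator:
  assumes T: "l2_compact_operator M T"
  shows "l2_compact_operator M (l2_center M \<circ> T)"
  unfolding l2_compact_operator_def
proof (intro conjI allI impI)
  note lin = l2_compact_operator_linear[OF T]
  show "l2_linear_operator M (l2_center M \<circ> T)"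
    by (rule l2_center_linear_operator[OF lin])
  fix f :: "nat \<Rightarrow> 'a \<Rightarrow> real" assume f: "\<forall>n. f n \<in> l2_ball M"
  obtain g \<sigma> where g: "g \<in> l2_space M" and \<sigma>: "strict_mono (\<sigma> :: nat \<Rightarrow> nat)"
    and lim: "(\<lambda>k. l2_norm M (\<lambda>x. T (f (\<sigma> k)) x - g x)) \<longlonglongrightarrow> 0"
    using T f unfolding l2_compact_operator_def by blast
  have Tf: "T (f k) \<in> l2_space M" for k
    using f by (intro l2_operator_closed[OF lin]) (simp add: l2_ball_def)
  have "l2_norm M (\<lambda>x. l2_center M (T (f k)) x - l2_center M g x) \<le> l2_norm M (\<lambda>x. T (f k) x - g x)"
    for k
  proof -
    have "l2_center M (\<lambda>x. T (f k) x - g x) = (\<lambda>x. l2_center M (T (f k)) x - l2_center M g x)"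
      using l2_space_integrable[OF Tf[of k]] l2_space_integrable[OF g]
      by (simp add: l2_center_def fun_eq_iff)
    then show ?thesis
      using l2_norm_center_le[OF l2_space_diff[OF Tf g], of k] by simp
  qed
  then have "(\<lambda>k. l2_norm M (\<lambda>x. l2_center M (T (f (\<sigma> k))) x - l2_center M g x)) \<longlonglongrightarrow> 0"
    by (intro metric_tendsto_imp_tendsto[OF lim] always_eventually) (simp add: l2_norm_nonneg)
  then show "\<exists>g\<in>l2_space M. \<exists>\<sigma> :: nat \<Rightarrow> nat. strict_mono \<sigma> \<and>
      (\<lambda>n. l2_norm M (\<lambda>x. (l2_center M \<circ> T) (f (\<sigma> n)) x - g x)) \<longlonglongrightarrow> 0"
    using l2_center_closed[OF g] \<sigma> by (intro bexI[of _ "l2_center M g"] exI[of _ \<sigma>]) simp_all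
qed

lemma singular_number_cong:
  assumes "\<And>f. f \<in> l2_space M \<Longrightarrow> A f = T f"
  shows "singular_number M A = singular_number M T"
proof -
  have "l2_eigenspace_TstarT M A c = l2_eigenspace_TstarT M T c" for c
    using assms by (auto simp: l2_eigenspace_TstarT_def)
  then show ?thesis by (simp add: singular_number_def singular_sequence_def)
qed

text \<open>
  Among the combinations of $f_0, \dots, f_{k+1}$ there is a nonzero $p$ orthogonal to $g_0,
  \dots, g_{k-1}$ for which $Tp$ has mean zero, as these are only $k + 1$ conditions. For this $p$
  one has $s_{k+1} \|p\| \le \|Tp\| = \|PTp\| \le \sigma_k \|p\|$.
\<close>

lemma schmidt_center_interlacing:
  assumes T: "l2_linear_operator M T" and S: "schmidt_system M T s f"
    and A: "schmidt_system M (l2_center M \<circ> T) \<sigma> g"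
  shows "s (Suc k) \<le> \<sigma> k"
proof -
  note fl2 = schmidt_systemD(2)[OF S] and gl2 = schmidt_systemD(2)[OF A]
  note closed = l2_operator_closed[OF T]
  define J where "J = {..Suc k}"
  have J: "finite J" "Suc k < card J" by (simp_all add: J_def)
  obtain c j where j: "j \<in> J" "c j \<noteq> 0"
    and c: "\<And>i. i < Suc k \<Longrightarrow>
      (\<Sum>j\<in>J. (if i < k then l2_inner M (f j) (g i) else (\<integral>x. T (f j) x \<partial>M)) * c j) = 0"
    using homogeneous_system_nontrivial_solution[OF J,
        of "\<lambda>i j. if i < k then l2_inner M (f j) (g i) else (\<integral>x. T (f j) x \<partial>M)"] by blast
  define p where "p = (\<lambda>x. \<Sum>j\<in>J. c j * f j x)"
  have p: "p \<in> l2_space M"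
    unfolding p_def by (intro l2_space_sum l2_space_scale fl2)
  have pg: "l2_inner M p (g i) = 0" if "i < k" for i
    unfolding p_def using c[of i] that fl2 gl2
    by (subst l2_inner_sum_left) (auto simp: l2_inner_scale_left l2_space_scale mult.commute)
  have "l2_inner M (T p) (\<lambda>x. 1) = (\<Sum>j\<in>J. c j * l2_inner M (T (f j)) (\<lambda>x. 1))"
    unfolding p_def by (rule l2_operator_inner_sum[OF T fl2 l2_space_const])
  also have "\<dots> = 0"
    using c[of k] by (simp add: integral_eq_l2_inner_const mult.commute)
  finally have "l2_center M (T p) = T p"
    by (simp add: l2_center_def integral_eq_l2_inner_const)
  then have upper: "l2_norm M (T p) \<le> \<sigma> k * l2_norm M p"
    using schmidt_systemD(9)[OF A p pg] by simp
  have p_sq: "(l2_norm M p)\<^sup>2 = (\<Sum>j\<in>J. (c j)\<^sup>2)"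
    unfolding l2_norm_squared p_def
    by (rule l2_orthonormal_combination_norm[OF _ J(1)])
      (use schmidt_systemD(1)[OF S] in \<open>simp add: l2_orthonormal_def\<close>)
  have pf: "l2_inner M (f j) p = c j" if "j \<in> J" for j
    unfolding p_def using l2_orthonormal_inner_combination[OF schmidt_systemD(1)[OF S] J(1)
        subset_UNIV UNIV_I, of c j] that by (simp add: l2_inner_commute)
  have "(s (Suc k) * l2_norm M p)\<^sup>2 = (\<Sum>j\<in>J. (s (Suc k))\<^sup>2 * (c j)\<^sup>2)"
    by (simp add: power_mult_distrib p_sq sum_distrib_left)
  also have "\<dots> \<le> (\<Sum>j\<in>J. (s j)\<^sup>2 * (c j)\<^sup>2)"
    using decseqD[OF schmidt_systemD(6)[OF S]] schmidt_systemD(5)[OF S]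
    by (intro sum_mono mult_right_mono power_mono) (auto simp: J_def)
  also have "\<dots> = (\<Sum>j\<in>J. c j * l2_inner M (T (f j)) (T p))"
    using pf schmidt_systemD(8)[OF S p]
    by (intro sum.cong) (auto simp: power2_eq_square)
  also have "\<dots> = l2_inner M (T p) (T p)"
    using l2_operator_inner_sum[OF T fl2 closed[OF p], where I = J and c = c]
    by (simp add: p_def)
  finally have "(s (Suc k) * l2_norm M p)\<^sup>2 \<le> (l2_norm M (T p))\<^sup>2"
    by (simp add: l2_norm_squared)
  then have "s (Suc k) * l2_norm M p \<le> \<sigma> k * l2_norm M p"
    using power2_le_imp_le[OF _ l2_norm_nonneg] upper by (meson order_trans)
  moreover have "0 < (l2_norm M p)\<^sup>2"
    unfolding p_sq using J(1) j by (intro sum_pos2[of _ j]) auto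
  then have "0 < l2_norm M p"
    using l2_norm_nonneg[of M p] by (auto simp: less_le)
  ultimately show ?thesis by simp
qed

end

section \<open>The Kantorovich-Rubinstein norm\<close>

locale compact_metric_l2 = infinite_dim_l2 M for M :: "'a::metric_space measure" +
  assumes compact_UNIV: "compact (UNIV :: 'a set)" and borel: "sets M = sets borel"
begin

text \<open>
  A bound for the oscillation that is uniform over all 1-Lipschitz functions: the diameter. It
  makes the supremum in the Kantorovich-Rubinstein norm finite.
\<close>

lemma lipschitz_bounded_diff:
  obtains D where "\<And>f x y. (\<And>x y. \<bar>f x - f y\<bar> \<le> dist x (y :: 'a)) \<Longrightarrow> \<bar>f x - f y :: real\<bar> \<le> D"
proof -
  obtain D where D: "\<And>x y :: 'a. dist x y \<le> D"
    using compact_imp_bounded[OF compact_UNIV, unfolded bounded_two_points] by auto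
  show thesis
  proof (rule that)
    show "\<bar>f x - f y\<bar> \<le> D" if "\<And>x y. \<bar>f x - f y\<bar> \<le> dist x y" for f :: "'a \<Rightarrow> real" and x y
      by (rule order_trans[OF that D])
  qed
qed

lemma lipschitz_l2_space:
  assumes lip: "\<And>x y. \<bar>f x - f y\<bar> \<le> dist x (y :: 'a)"
  shows "(f :: 'a \<Rightarrow> real) \<in> l2_space M"
proof -
  have "continuous_on UNIV f"
    unfolding continuous_on_iff dist_real_def using lip order_le_less_trans by metis
  then have meas: "f \<in> borel_measurable M"
    using borel_measurable_continuous_onI measurable_cong_sets[OF borel refl] by blast
  obtain D where D: "\<And>f x y. (\<And>x y. \<bar>f x - f y\<bar> \<le> dist x (y :: 'a)) \<Longrightarrow> \<bar>f x - f y :: real\<bar> \<le> D"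
    using lipschitz_bounded_diff by blast
  have "\<bar>f x\<bar> \<le> \<bar>f undefined\<bar> + D" for x
    using D[of f x undefined, OF lip] by linarith
  then have "norm ((f x)\<^sup>2) \<le> (\<bar>f undefined\<bar> + D)\<^sup>2" for x
    using power_mono[of "\<bar>f x\<bar>" "\<bar>f undefined\<bar> + D" 2] by simp
  then have "integrable M (\<lambda>x. (f x)\<^sup>2)"
    using meas by (intro integrable_const_bound) auto
  with meas show ?thesis by (simp add: l2_space_def)
qed

lemma inner_zero_mean_shift:
  assumes "u \<in> l2_zero_mean M" "f \<in> l2_space M"
  shows "l2_inner M u (\<lambda>x. f x - c) = l2_inner M u f"
proof -
  have "l2_inner M u (\<lambda>x. f x - c) = l2_inner M u f - c * (\<integral>x. u x \<partial>M)"
    using assms by (subst l2_inner_diff_right) (auto simp: l2_zero_mean_closed l2_space_const,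
        simp add: l2_inner_def)
  then show ?thesis using assms(1) by (simp add: l2_zero_mean_def)
qed

lemma kr_norm_upper:
  assumes u: "u \<in> l2_zero_mean M" and lip: "\<And>x y. \<bar>f x - f y\<bar> \<le> dist x y"
  shows "l2_inner M u f \<le> kr_norm M u"
proof -
  obtain D where D: "\<And>f x y. (\<And>x y. \<bar>f x - f y\<bar> \<le> dist x (y :: 'a)) \<Longrightarrow> \<bar>f x - f y :: real\<bar> \<le> D"
    using lipschitz_bounded_diff by blast
  have "l2_inner M u h \<le> (\<integral>x. \<bar>u x\<bar> * D \<partial>M)"
    if h: "\<And>x y. \<bar>h x - h y\<bar> \<le> dist x y" for h
  proof -
    \<comment> \<open>Here \<open>undefined\<close> is an arbitrary base point: normalizing at it makes all test functions bounded by the same constant.\<close>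
    have hl2: "(\<lambda>x. h x - h undefined) \<in> l2_space M"
      by (intro l2_space_diff l2_space_const lipschitz_l2_space h)
    have "l2_inner M u h = (\<integral>x. u x * (h x - h undefined) \<partial>M)"
      using inner_zero_mean_shift[OF u lipschitz_l2_space[OF h], of "h undefined"]
      by (simp add: l2_inner_def)
    also have "\<dots> \<le> (\<integral>x. \<bar>u x\<bar> * D \<partial>M)"
    proof (rule integral_mono)
      show "integrable M (\<lambda>x. u x * (h x - h undefined))"
        by (rule l2_space_integrable_mult[OF l2_zero_mean_closed[OF u] hl2])
      show "integrable M (\<lambda>x. \<bar>u x\<bar> * D)"
        using l2_space_integrable[OF l2_zero_mean_closed[OF u]] by simp
      show "u x * (h x - h undefined) \<le> \<bar>u x\<bar> * D" for x
      proof -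
        have "u x * (h x - h undefined) \<le> \<bar>u x\<bar> * \<bar>h x - h undefined\<bar>"
          by (simp flip: abs_mult)
        also have "\<dots> \<le> \<bar>u x\<bar> * D"
          by (intro mult_left_mono D h) simp
        finally show ?thesis .
      qed
    qed
    finally show ?thesis .
  qed
  then show ?thesis
    unfolding kr_norm_def l2_inner_def[symmetric] using lip
    by (intro cSUP_upper2[of _ _ f] bdd_aboveI2) auto
qed

lemma kr_norm_nonneg: "u \<in> l2_zero_mean M \<Longrightarrow> 0 \<le> kr_norm M u"
  using kr_norm_upper[of u "\<lambda>x. 0"] by (simp add: l2_inner_def)

text \<open>
  Subtracting a constant does not change the pairing with a zero-mean function, so only the test
  functions that vanish at \<open>x0\<close> matter.
\<close>

lemma kr_norm_le:
  assumes u: "u \<in> l2_zero_mean M" and le: "\<And>f. f \<in> Lip1 x0 \<Longrightarrow> l2_inner M u f \<le> K"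
  shows "kr_norm M u \<le> K"
  unfolding kr_norm_def l2_inner_def[symmetric]
proof (rule cSUP_least)
  show "{f :: 'a \<Rightarrow> real. \<forall>x y. \<bar>f x - f y\<bar> \<le> dist x y} \<noteq> {}"
    by (auto intro!: exI[of _ "\<lambda>x. 0"])
  fix f :: "'a \<Rightarrow> real" assume "f \<in> {f. \<forall>x y. \<bar>f x - f y\<bar> \<le> dist x y}"
  then have f: "\<And>x y. \<bar>f x - f y\<bar> \<le> dist x y" by simp
  then have "(\<lambda>x. f x - f x0) \<in> Lip1 x0" by (simp add: Lip1_def)
  from le[OF this] show "l2_inner M u f \<le> K"
    using inner_zero_mean_shift[OF u lipschitz_l2_space[OF f]] by simp
qed

section \<open>A lower bound from an operator with values in the Lipschitz functions\<close>

text \<open>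
  With the Schmidt system $(f_k)$ of $PT$, the left singular vectors $u_k = PTf_k / \sigma_k$ are
  paired by $(u_k, Tf_k) = \sigma_k$ with the Lipschitz functions $Tf_k$.
\<close>

lemma ex_orthonormal_kr_norm_ge:
  assumes T: "l2_compact_operator M T" and lip: "l2_subset M (T ` l2_ball M) (Lip1 x0)"
  shows "\<exists>u. l2_orthonormal M UNIV u \<and> (\<forall>k. u k \<in> l2_zero_mean M) \<and>
    (\<forall>k. singular_number M (l2_center M \<circ> T) k \<le> kr_norm M (u k))"
proof -
  define A where "A = l2_center M \<circ> T"
  define \<sigma> where "\<sigma> = singular_number M A"
  have linT: "l2_linear_operator M T" and linA: "l2_linear_operator M A"
    using T l2_center_linear_operator by (auto simp: A_def l2_compact_operator_linear)
  obtain f where S: "schmidt_system M A \<sigma> f"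
    unfolding \<sigma>_def using schmidt_system_singular_number[OF l2_center_compact_operator[OF T]]
    unfolding A_def by blast
  note fl2 = schmidt_systemD(2)[OF S] and orth = schmidt_systemD(3)[OF S]
    and \<sigma>0 = schmidt_systemD(5)[OF S] and eig = schmidt_systemD(8)[OF S]
  have Af: "A (f k) \<in> l2_zero_mean M" for k
    using l2_center_zero_mean[OF l2_operator_closed[OF linT fl2]] by (simp add: A_def)
  \<comment> \<open>Where $\sigma_k = 0$ any unit vector orthogonal to its predecessors will do; orthogonality to the constant $1$ gives mean zero.\<close>
  define P where "P u k r \<longleftrightarrow> r \<in> l2_zero_mean M \<and> l2_inner M r r = 1 \<and>
      (\<forall>i<k. l2_inner M r (u i) = 0) \<and> (\<sigma> k \<noteq> 0 \<longrightarrow> r = (\<lambda>x. 1 / \<sigma> k * A (f k) x))"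
    for u :: "nat \<Rightarrow> 'a \<Rightarrow> real" and k r
  have "\<exists>u. \<forall>k. P u k (u k)"
  proof (rule dependent_wellorder_choice)
    show "P u k r = P v k r" if "\<And>i. i < k \<Longrightarrow> u i = v i" for r u v k
      using that by (simp add: P_def)
    show "\<exists>r. P u k r" if IH: "\<And>i. i < k \<Longrightarrow> P u i (u i)" for k u
    proof (cases "\<sigma> k = 0")
      case True
      define w where "w i = (if i < k then u i else (\<lambda>x. 1))" for i
      have "w i \<in> l2_space M" for i
        using IH l2_space_const by (simp add: w_def P_def l2_zero_mean_closed)
      then obtain r where r: "r \<in> l2_space M" "l2_norm M r = 1"
        and rw: "\<forall>i<Suc k. l2_inner M r (w i) = 0"
        using ex_unit_orthogonal[of "Suc k" w] by blast
      have "l2_inner M r (u i) = 0" if "i < k" for i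
        using rw that by (auto simp: w_def dest: spec[of _ i])
      moreover have "(\<integral>x. r x \<partial>M) = 0"
        using rw by (auto simp: w_def integral_eq_l2_inner_const dest: spec[of _ k])
      ultimately have "P u k r"
        using r True l2_norm_squared[of M r] by (simp add: P_def l2_zero_mean_def)
      then show ?thesis by blast
    next
      case False
      define r where "r = (\<lambda>x. 1 / \<sigma> k * A (f k) x)"
      have "r \<in> l2_zero_mean M"
        using Af[of k] l2_space_scale[of "A (f k)" M "1 / \<sigma> k"]
        by (simp add: r_def l2_zero_mean_def)
      moreover have "l2_inner M r r = 1"
        using eig[OF fl2, of k k] orth[of k k] False
        by (simp only: r_def l2_inner_scale_left l2_inner_scale_right) (simp add: power2_eq_square)
      moreover have "l2_inner M r (u i) = 0" if i: "i < k" for i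
      proof -
        have "\<sigma> i \<noteq> 0"
          using decseqD[OF schmidt_systemD(6)[OF S], of i k] i \<sigma>0[of k] False by simp
        then have "u i = (\<lambda>x. 1 / \<sigma> i * A (f i) x)" using IH[OF i] by (simp add: P_def)
        then show ?thesis
          using eig[OF fl2, of k i] orth[of k i] i
          by (simp only: r_def l2_inner_scale_left l2_inner_scale_right) simp
      qed
      ultimately have "P u k r" by (simp add: P_def r_def)
      then show ?thesis by blast
    qed
  qed
  then obtain u where u: "\<And>k. P u k (u k)" by blast
  have mean: "u k \<in> l2_zero_mean M" for k using u[of k] by (simp add: P_def)
  have lower: "l2_inner M (u j) (u i) = 0" if "i < j" for i j
    using u[of j] that by (simp add: P_def)
  have "l2_inner M (u i) (u j) = (if i = j then 1 else 0)" for i j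
    using u[of i] lower[of i j] lower[of j i] l2_inner_commute[of M "u i" "u j"]
    by (cases i j rule: linorder_cases) (auto simp: P_def)
  then have "l2_orthonormal M UNIV u"
    using mean by (simp add: l2_orthonormal_def l2_zero_mean_closed)
  moreover have "\<sigma> k \<le> kr_norm M (u k)" for k
  proof (cases "\<sigma> k = 0")
    case True
    then show ?thesis using kr_norm_nonneg[OF mean] by simp
  next
    case False
    have "l2_norm M (f k) = 1" by (simp add: l2_norm_def orth)
    then have "f k \<in> l2_ball M" using fl2 by (simp add: l2_ball_def)
    then obtain h where h: "h \<in> Lip1 x0" and ae: "AE x in M. T (f k) x = h x"
      using lip by (auto simp: l2_subset_def)
    have hlip: "\<bar>h x - h y\<bar> \<le> dist x y" for x y using h by (simp add: Lip1_def)
    note Tf = l2_operator_closed[OF linT fl2[of k]]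
    have "\<sigma> k = 1 / \<sigma> k * l2_inner M (A (f k)) (A (f k))"
      using eig[OF fl2, of k k] orth[of k k] False by (simp add: power2_eq_square)
    also have "\<dots> = l2_inner M (A (f k)) (u k)"
      using u[of k] False by (simp add: P_def l2_inner_scale_right del: times_divide_eq_left)
    also have "\<dots> = l2_inner M (T (f k)) (u k)"
      using l2_inner_center[OF mean Tf] by (simp add: A_def)
    also have "\<dots> = l2_inner M h (u k)"
      by (rule l2_inner_cong_AE[OF Tf lipschitz_l2_space[OF hlip] l2_zero_mean_closed[OF mean] ae])
    also have "\<dots> \<le> kr_norm M (u k)"
      using kr_norm_upper[OF mean hlip] by (simp add: l2_inner_commute)
    finally show ?thesis .
  qed
  ultimately show ?thesis using mean unfolding \<sigma>_def A_def by blast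
qed

end

lemma not_summable_mono_shift:
  fixes h s t :: "_ \<Rightarrow> real"
  assumes h: "mono_on {0..} h" "\<And>x. 0 \<le> x \<Longrightarrow> 0 \<le> h x"
    and st: "\<And>k. 0 \<le> s k" "\<And>k. s (Suc k) \<le> t k" and div: "\<not> summable (\<lambda>k. h (s k))"
  shows "\<not> summable (\<lambda>k. h (t k))"
proof
  assume "summable (\<lambda>k. h (t k))"
  then have "summable (\<lambda>k. h (s (Suc k)))"
  proof (rule summable_comparison_test_ev[rotated])
    have "norm (h (s (Suc k))) \<le> h (t k)" for k
      using h(2)[OF st(1)] mono_onD[OF h(1)] st order_trans[OF st(1) st(2)] by simp
    then show "\<forall>\<^sub>F k in sequentially. norm (h (s (Suc k))) \<le> h (t k)" by simp
  qed
  then have "summable (\<lambda>k. h (s k))" by (rule summable_Suc_iff[THEN iffD1])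
  with div show False ..
qed

section \<open>The growth of the function \<open>\<phi>\<close>\<close>

text \<open>
  A decrease from \<open>s\<close> to \<open>t\<close> would, by concavity, continue at the same
  rate and make \<open>r\<close> negative far out.
\<close>

lemma concave_on_pos_mono:
  fixes r :: "real \<Rightarrow> real"
  assumes conc: "concave_on {0<..} r" and pos: "\<And>x. 0 < x \<Longrightarrow> 0 < r x"
    and st: "0 < s" "s \<le> t"
  shows "r s \<le> r t"
proof (rule ccontr)
  assume "\<not> r s \<le> r t"
  then have gt: "r t < r s" by simp
  \<comment> \<open>The point $t$ divides the segment from $s$ to a far point $v$ in the ratio $c : 1 - c$, where $(1 - c) r(s)$ still exceeds $r(t)$.\<close>
  define c where "c = (r s - r t) / (2 * r s)"
  have rs: "0 < r s" "0 < r t" using pos st by auto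
  have c: "0 < c" "c \<le> 1" using gt rs by (auto simp: c_def)
  define v where "v = s + (t - s) / c"
  have v: "0 < v" using c st by (simp add: v_def add_pos_nonneg)
  have "c * v = c * s + (t - s)"
    using c by (simp add: v_def distrib_left)
  then have "t = (1 - c) *\<^sub>R s + c *\<^sub>R v"
    by (simp add: algebra_simps)
  then have "(1 - c) * r s + c * r v \<le> r t"
    using concave_onD[OF conc, of c s v] c st v by simp
  also have "r t < (r s + r t) / 2" using gt by simp
  also have "\<dots> = (1 - c) * r s"
    using rs by (simp add: c_def field_simps)
  finally show False
    using c pos[OF v] by (simp add: mult_less_0_iff)
qed

text \<open>
  With $x = \varphi(y)$ the hypothesis reads $y / \sqrt{\varphi(y)} = r(\varphi(y)^{-1/2})$. Here
  $r$ is nondecreasing, whether it is concave and positive or pseudo-concave, so $y /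
  \sqrt{\varphi(y)}$ is nonincreasing in $y$.
\<close>

lemma quotient_by_square_mono:
  fixes \<phi> r :: "real \<Rightarrow> real"
  assumes mono: "strict_mono_on {0..} \<phi>" and range: "\<phi> ` {0..} = {0..}"
    and inverse: "\<And>x. 0 < x \<Longrightarrow> the_inv_into {0..} \<phi> x = x powr (1/2) * r (x powr (-1/2))"
    and r: "concave_on {0<..} r \<or> pseudo_concave r"
    and ab: "0 < a" "a \<le> b"
  shows "\<phi> a * b\<^sup>2 \<le> \<phi> b * a\<^sup>2"
proof -
  have inj: "inj_on \<phi> {0..}" using mono by (rule strict_mono_on_imp_inj_on)
  have nonneg: "0 \<le> \<phi> y" if "0 \<le> y" for y using range that by auto
  have pos: "0 < \<phi> y" if "0 < y" for y
    using strict_mono_onD[OF mono, of 0 y] nonneg[of 0] that by simp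
  have inv: "y = sqrt (\<phi> y) * r (1 / sqrt (\<phi> y))" if y: "0 < y" for y
    using inverse[OF pos[OF y]] the_inv_into_f_f[OF inj, of y] y pos[OF y]
    by (simp add: powr_half_sqrt powr_minus_divide)
  have r_mono: "r s \<le> r t" if st: "0 < s" "s \<le> t" for s t
    using r
  proof
    assume "pseudo_concave r"
    moreover have "0 < t" "max 1 (s / t) = 1" using st by (auto simp: max_def)
    ultimately show ?thesis
      using st(1) unfolding pseudo_concave_def by (metis mult_1)
  next
    assume "concave_on {0<..} r"
    moreover have "0 < r x" if x: "0 < x" for x
    proof -
      have "1 / x\<^sup>2 \<in> \<phi> ` {0..}" using range by simp
      then obtain y where y: "0 \<le> y" "\<phi> y = 1 / x\<^sup>2" by auto
      obtain z where z: "0 \<le> z" "\<phi> z = 0" using range by (metis atLeast_iff imageE order_refl)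
      have "y \<noteq> z" using y(2) z(2) x by auto
      have "0 < y"
      proof (rule ccontr)
        assume "\<not> 0 < y"
        then have "y < z" using y(1) z(1) \<open>y \<noteq> z\<close> by simp
        then have "\<phi> y < \<phi> z" using strict_mono_onD[OF mono, of y z] y(1) z(1) by simp
        then show False using y(2) z(2) x by (simp add: divide_less_0_iff)
      qed
      moreover have "y = r x / x"
        using inv[OF \<open>0 < y\<close>] x y(2) by (simp add: real_sqrt_divide)
      ultimately show ?thesis using x by (simp add: zero_less_divide_iff)
    qed
    ultimately show ?thesis using st by (rule concave_on_pos_mono)
  qed
  have b: "0 < b" using ab by simp
  have \<phi>ab: "\<phi> a \<le> \<phi> b" using strict_mono_onD[OF mono, of a b] ab by (cases "a = b") auto
  have "r (1 / sqrt (\<phi> b)) \<le> r (1 / sqrt (\<phi> a))"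
    using pos[OF ab(1)] pos[OF b] \<phi>ab by (intro r_mono) (auto simp: frac_le)
  moreover have "r (1 / sqrt (\<phi> b)) = b / sqrt (\<phi> b)" "r (1 / sqrt (\<phi> a)) = a / sqrt (\<phi> a)"
    using inv[OF b] inv[OF ab(1)] pos[OF b] pos[OF ab(1)] by (simp_all add: field_simps)
  ultimately have "b * sqrt (\<phi> a) \<le> a * sqrt (\<phi> b)"
    using pos[OF b] pos[OF ab(1)] by (simp add: field_simps)
  then have "(b * sqrt (\<phi> a))\<^sup>2 \<le> (a * sqrt (\<phi> b))\<^sup>2"
    using b nonneg[of a] ab by (intro power_mono) auto
  then show ?thesis
    using pos[OF b] pos[OF ab(1)] by (simp add: power_mult_distrib mult.commute)
qed

text \<open>
  A monotone quotient $\varphi(y)/y^2$ does not make $\varphi(\sqrt y)$ convex, but it does give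
  the supporting line $\varphi(y) \ge (\varphi(c)/c^2) (y^2 - c^2)$: for $y \ge c$ even without
  the term $-c^2$, and for $y < c$ because the right side is not positive. Integrating it against
  $p$ loses $c^2$, which the factor $2$ in the hypothesis on $c$ absorbs.
\<close>

lemma half_quadratic_jensen:
  fixes \<phi> :: "real \<Rightarrow> real"
  assumes nonneg: "\<And>y. 0 \<le> y \<Longrightarrow> 0 \<le> \<phi> y"
    and quot: "\<And>a b. 0 < a \<Longrightarrow> a \<le> b \<Longrightarrow> \<phi> a * b\<^sup>2 \<le> \<phi> b * a\<^sup>2"
    and p: "\<And>j. 0 \<le> p j" "summable p" "(\<Sum>j. p j) \<le> 1"
    and s: "\<And>j. 0 \<le> s j" "summable (\<lambda>j. p j * (s j)\<^sup>2)" "summable (\<lambda>j. p j * \<phi> (s j))"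
    and c: "0 < c" "2 * c\<^sup>2 \<le> (\<Sum>j. p j * (s j)\<^sup>2)"
  shows "\<phi> c \<le> (\<Sum>j. p j * \<phi> (s j))"
proof -
  define \<kappa> where "\<kappa> = \<phi> c / c\<^sup>2"
  have \<kappa>: "0 \<le> \<kappa>" using nonneg[of c] c by (simp add: \<kappa>_def)
  have tangent: "\<kappa> * (y\<^sup>2 - c\<^sup>2) \<le> \<phi> y" if "0 \<le> y" for y
  proof (cases "c \<le> y")
    case True
    have "\<kappa> * (y\<^sup>2 - c\<^sup>2) \<le> \<kappa> * y\<^sup>2" using \<kappa> by (intro mult_left_mono) auto
    also have "\<dots> \<le> \<phi> y" using quot[OF c(1) True] c by (simp add: \<kappa>_def field_simps)
    finally show ?thesis .
  next
    case False
    then have "y\<^sup>2 \<le> c\<^sup>2" using that by (intro power_mono) auto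
    then have "\<kappa> * (y\<^sup>2 - c\<^sup>2) \<le> 0" using \<kappa> by (simp add: mult_nonneg_nonpos)
    then show ?thesis using nonneg[OF that] by simp
  qed
  have "\<phi> c = \<kappa> * (2 * c\<^sup>2 - c\<^sup>2 * 1)" using c by (simp add: \<kappa>_def)
  also have "\<dots> \<le> \<kappa> * ((\<Sum>j. p j * (s j)\<^sup>2) - c\<^sup>2 * (\<Sum>j. p j))"
    using \<kappa> c p(3) by (intro mult_left_mono diff_mono) auto
  also have "\<dots> = (\<Sum>j. \<kappa> * (p j * (s j)\<^sup>2 - c\<^sup>2 * p j))"
    using p s by (simp add: suminf_mult suminf_diff[symmetric] summable_diff summable_mult)
  also have "\<dots> \<le> (\<Sum>j. p j * \<phi> (s j))"
  proof (rule suminf_le)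
    show "\<kappa> * (p j * (s j)\<^sup>2 - c\<^sup>2 * p j) \<le> p j * \<phi> (s j)" for j
      using mult_left_mono[OF tangent[OF s(1)] p(1), of j j] by (simp add: algebra_simps)
  qed (use p s in \<open>auto intro!: summable_mult summable_diff\<close>)
  finally show ?thesis .
qed

section \<open>An upper bound for Bessel sequences\<close>

text \<open>
  The remainder $g - \sum_{j<n} (g, f_j) f_j$ is orthogonal to $f_0, \dots, f_{n-1}$, so $T$ maps
  it to a vector of norm at most $s_n \|g\|$.
\<close>

lemma schmidt_expansion:
  assumes lin: "l2_linear_operator M T" and S: "schmidt_system M T s f"
    and g: "g \<in> l2_space M" and u: "u \<in> l2_space M"
  shows "(\<lambda>j. l2_inner M g (f j) * l2_inner M (T (f j)) u) sums l2_inner M (T g) u"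
proof -
  note fl2 = schmidt_systemD(2)[OF S]
  note closed = l2_operator_closed[OF lin]
  define q where "q n = (\<lambda>x. \<Sum>j<n. l2_inner M g (f j) * f j x)" for n
  define p where "p n = (\<lambda>x. g x - q n x)" for n
  have q: "q n \<in> l2_space M" for n
    unfolding q_def by (intro l2_space_sum l2_space_scale fl2)
  have p: "p n \<in> l2_space M" for n
    unfolding p_def by (intro l2_space_diff g q)
  have orth: "l2_orthonormal M {..<n} f" for n
    using schmidt_systemD(1)[OF S] by (simp add: l2_orthonormal_def)
  have pf: "l2_inner M (p n) (f i) = 0" if "i < n" for n i
    unfolding p_def using l2_orthonormal_inner_combination[OF schmidt_systemD(1)[OF S] finite_lessThan
        subset_UNIV UNIV_I, of "\<lambda>j. l2_inner M g (f j)" n i] that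
    by (simp add: l2_inner_diff_left g q fl2) (simp add: q_def)
  have pg: "l2_norm M (p n) \<le> l2_norm M g" for n
    unfolding l2_norm_def p_def q_def l2_bessel_inequality(1)[OF orth finite_lessThan g]
    by (simp add: sum_nonneg)
  have remainder: "\<bar>l2_inner M (T (p n)) u\<bar> \<le> s n * (l2_norm M g * l2_norm M u)" for n
  proof -
    have "\<bar>l2_inner M (T (p n)) u\<bar> \<le> l2_norm M (T (p n)) * l2_norm M u"
      by (rule l2_cauchy_schwarz[OF closed[OF p] u])
    also have "\<dots> \<le> (s n * l2_norm M g) * l2_norm M u"
      using schmidt_systemD(9)[OF S p pf] mult_left_mono[OF pg schmidt_systemD(5)[OF S]]
      by (intro mult_right_mono l2_norm_nonneg) (meson order_trans)
    finally show ?thesis by (simp add: mult.assoc)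
  qed
  have "(\<lambda>n. l2_inner M (T g) u - l2_inner M (T (p n)) u) \<longlonglongrightarrow> l2_inner M (T g) u - 0"
  proof (intro tendsto_diff tendsto_const)
    have "(\<lambda>n. s n * (l2_norm M g * l2_norm M u)) \<longlonglongrightarrow> 0"
      using tendsto_mult_right[OF schmidt_systemD(7)[OF S]] by simp
    then show "(\<lambda>n. l2_inner M (T (p n)) u) \<longlonglongrightarrow> 0"
      by (rule Lim_null_comparison[rotated]) (simp add: remainder)
  qed
  moreover have "(\<Sum>j<n. l2_inner M g (f j) * l2_inner M (T (f j)) u)
      = l2_inner M (T g) u - l2_inner M (T (p n)) u" for n
    using l2_operator_inner_sum[OF lin fl2 u, where c = "\<lambda>j. l2_inner M g (f j)" and I = "{..<n}"]
      l2_operator_inner_diff[OF lin g q u, of n]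
    by (simp add: p_def q_def)
  ultimately show ?thesis by (simp add: sums_def)
qed

text \<open>
  The squared coefficient of \<open>u\<close> along the left singular vector $Tf_j / s_j$.
  Division by zero makes the weight \<open>0\<close> where $s_j = 0$ and this vector does not
  exist.
\<close>

definition schmidt_weight ::
    "'a measure \<Rightarrow> (('a \<Rightarrow> real) \<Rightarrow> 'a \<Rightarrow> real) \<Rightarrow> (nat \<Rightarrow> real) \<Rightarrow> (nat \<Rightarrow> 'a \<Rightarrow> real) \<Rightarrow>
      ('a \<Rightarrow> real) \<Rightarrow> nat \<Rightarrow> real" where
  "schmidt_weight M T s f u j = (l2_inner M (T (f j)) u / s j)\<^sup>2"

lemma schmidt_weight_nonneg: "0 \<le> schmidt_weight M T s f u j"
  by (simp add: schmidt_weight_def)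

lemma schmidt_weight_mult:
  assumes lin: "l2_linear_operator M T" and S: "schmidt_system M T s f" and u: "u \<in> l2_space M"
  shows "schmidt_weight M T s f u j * (s j)\<^sup>2 = (l2_inner M (T (f j)) u)\<^sup>2"
proof (cases "s j = 0")
  case True
  have "l2_inner M (T (f j)) u = 0"
    using l2_cauchy_schwarz[OF l2_operator_closed[OF lin schmidt_systemD(2)[OF S]] u, of j]
      schmidt_systemD(4)[OF S, of j] True by simp
  with True show ?thesis by simp
qed (simp add: schmidt_weight_def power_divide)

text \<open>
  Bessel's inequality for the left singular vectors.
\<close>

lemma schmidt_weight_sum_le:
  assumes lin: "l2_linear_operator M T" and S: "schmidt_system M T s f" and u: "u \<in> l2_space M"
  shows "summable (schmidt_weight M T s f u)"
    and "(\<Sum>j. schmidt_weight M T s f u j) \<le> l2_inner M u u"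
proof -
  note fl2 = schmidt_systemD(2)[OF S] and eig = schmidt_systemD(8)[OF S]
  note closed = l2_operator_closed[OF lin]
  have partial: "(\<Sum>j<n. schmidt_weight M T s f u j) \<le> l2_inner M u u" for n
  proof -
    define I where "I = {j. j < n \<and> s j \<noteq> 0}"
    define v where "v j = (\<lambda>x. 1 / s j * T (f j) x)" for j
    have v: "l2_orthonormal M I v"
      unfolding l2_orthonormal_def
    proof (intro conjI ballI)
      show "v i \<in> l2_space M" for i
        unfolding v_def by (intro l2_space_scale closed fl2)
      show "l2_inner M (v i) (v j) = (if i = j then 1 else 0)" if "i \<in> I" "j \<in> I" for i j
        using that eig[OF fl2, of i j] schmidt_systemD(3)[OF S, of i j]
        by (simp only: v_def l2_inner_scale_left l2_inner_scale_right)
          (simp add: I_def power2_eq_square)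
    qed
    have "(\<Sum>j<n. schmidt_weight M T s f u j) = (\<Sum>j\<in>I. schmidt_weight M T s f u j)"
      by (rule sum.mono_neutral_right) (auto simp: I_def schmidt_weight_def)
    also have "\<dots> = (\<Sum>j\<in>I. (l2_inner M u (v j))\<^sup>2)"
      by (simp only: v_def l2_inner_scale_right) (simp add: schmidt_weight_def l2_inner_commute)
    also have "\<dots> \<le> l2_inner M u u"
      by (rule l2_bessel_inequality(2)[OF v _ u]) (simp add: I_def)
    finally show ?thesis .
  qed
  then show "summable (schmidt_weight M T s f u)"
    by (intro summableI_nonneg_bounded schmidt_weight_nonneg) 
  then show "(\<Sum>j. schmidt_weight M T s f u j) \<le> l2_inner M u u"
    using partial by (rule suminf_le_const)
qed

text \<open>
  The Schmidt expansion of $(Tg, u)$ and the Cauchy-Schwarz inequality, with $\sum_j (g, f_j)^2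
  \le 1$.
\<close>

lemma schmidt_inner_le:
  assumes lin: "l2_linear_operator M T" and S: "schmidt_system M T s f"
    and g: "g \<in> l2_ball M" and u: "u \<in> l2_space M"
  shows "summable (\<lambda>j. schmidt_weight M T s f u j * (s j)\<^sup>2)"
    and "l2_inner M (T g) u \<le> sqrt (\<Sum>j. schmidt_weight M T s f u j * (s j)\<^sup>2)"
proof -
  let ?w = "\<lambda>j. schmidt_weight M T s f u j * (s j)\<^sup>2"
  have gl2: "g \<in> l2_space M" and g1: "l2_inner M g g \<le> 1"
    using g power_le_one[OF l2_norm_nonneg, of M g 2] by (auto simp: l2_ball_def l2_norm_squared)
  have w0: "0 \<le> ?w j" for j by (simp add: schmidt_weight_nonneg)
  show sm: "summable ?w"
  proof (rule summable_comparison_test_ev)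
    show "summable (\<lambda>j. schmidt_weight M T s f u j * (s 0)\<^sup>2)"
      by (rule summable_mult2[OF schmidt_weight_sum_le(1)[OF lin S u]])
    have "?w j \<le> schmidt_weight M T s f u j * (s 0)\<^sup>2" for j
      using decseqD[OF schmidt_systemD(6)[OF S], of 0 j] schmidt_systemD(5)[OF S, of j]
      by (intro mult_left_mono power_mono schmidt_weight_nonneg) auto
    then show "\<forall>\<^sub>F j in sequentially. norm (?w j) \<le> schmidt_weight M T s f u j * (s 0)\<^sup>2"
      using w0 by simp
  qed
  have "(\<Sum>j<n. l2_inner M g (f j) * l2_inner M (T (f j)) u) \<le> sqrt (\<Sum>j. ?w j)" for n
  proof (rule real_le_rsqrt)
    have "l2_orthonormal M {..<n} f"
      using schmidt_systemD(1)[OF S] by (simp add: l2_orthonormal_def)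
    note bessel = l2_bessel_inequality(2)[OF this finite_lessThan gl2]
    have "(\<Sum>j<n. l2_inner M g (f j) * l2_inner M (T (f j)) u)\<^sup>2
        \<le> (\<Sum>j<n. (l2_inner M g (f j))\<^sup>2) * (\<Sum>j<n. (l2_inner M (T (f j)) u)\<^sup>2)"
      by (rule Cauchy_Schwarz_ineq_sum)
    also have "\<dots> \<le> 1 * (\<Sum>j<n. (l2_inner M (T (f j)) u)\<^sup>2)"
      using bessel g1 by (intro mult_right_mono sum_nonneg) auto
    also have "\<dots> = (\<Sum>j<n. ?w j)"
      by (simp add: schmidt_weight_mult[OF lin S u])
    also have "\<dots> \<le> (\<Sum>j. ?w j)"
      using w0 by (intro sum_le_suminf sm) auto
    finally show "(\<Sum>j<n. l2_inner M g (f j) * l2_inner M (T (f j)) u)\<^sup>2 \<le> (\<Sum>j. ?w j)" .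
  qed
  then show "l2_inner M (T g) u \<le> sqrt (\<Sum>j. ?w j)"
    using schmidt_expansion[OF lin S gl2 u] unfolding sums_def
    by (intro LIMSEQ_le_const2) auto
qed

text \<open>
  The Bessel bound is only available for zero-mean test functions, but $Tf_j$ may be replaced by
  its projection $PTf_j$: the $u_k$ do not see the difference, and the norm does not grow.
\<close>

lemma (in prob_space) schmidt_weight_bessel_sum_le:
  assumes lin: "l2_linear_operator M T" and S: "schmidt_system M T s f"
    and u: "\<And>k. u k \<in> l2_zero_mean M"
    and bessel: "\<And>g. g \<in> l2_zero_mean M \<Longrightarrow> summable (\<lambda>k. \<bar>l2_inner M g (u k)\<bar>\<^sup>2) \<and>
      (\<Sum>k. \<bar>l2_inner M g (u k)\<bar>\<^sup>2) \<le> B\<^sup>2 * (l2_norm M g)\<^sup>2"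
  shows "(\<Sum>k<n. schmidt_weight M T s f (u k) j) \<le> B\<^sup>2"
proof (cases "s j = 0")
  case True
  then show ?thesis by (simp add: schmidt_weight_def)
next
  case False
  define v where "v = l2_center M (T (f j))"
  have Tf: "T (f j) \<in> l2_space M"
    by (rule l2_operator_closed[OF lin schmidt_systemD(2)[OF S]])
  have v: "v \<in> l2_zero_mean M" unfolding v_def by (rule l2_center_zero_mean[OF Tf])
  have inner_v: "l2_inner M v (u k) = l2_inner M (T (f j)) (u k)" for k
    unfolding v_def by (rule l2_inner_center[OF u Tf])
  have "(\<Sum>k<n. \<bar>l2_inner M v (u k)\<bar>\<^sup>2) \<le> (\<Sum>k. \<bar>l2_inner M v (u k)\<bar>\<^sup>2)"
    using bessel[OF v] by (intro sum_le_suminf) auto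
  also have "\<dots> \<le> B\<^sup>2 * (l2_norm M v)\<^sup>2" using bessel[OF v] by simp
  also have "\<dots> \<le> B\<^sup>2 * (s j)\<^sup>2"
    using l2_norm_center_le[OF Tf] schmidt_systemD(4)[OF S, of j]
    by (intro mult_left_mono power_mono) (auto simp: v_def l2_norm_nonneg)
  finally have "(\<Sum>k<n. (l2_inner M (T (f j)) (u k))\<^sup>2) \<le> B\<^sup>2 * (s j)\<^sup>2"
    by (simp add: inner_v)
  then have "(\<Sum>k<n. (l2_inner M (T (f j)) (u k))\<^sup>2) / (s j)\<^sup>2 \<le> B\<^sup>2"
    using False by (simp add: divide_le_eq)
  then show ?thesis
    by (simp add: schmidt_weight_def power_divide sum_divide_distrib)
qed

lemma (in compact_metric_l2) kr_norm_le_schmidt: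
  assumes lin: "l2_linear_operator M T" and S: "schmidt_system M T s f"
    and lip: "l2_subset M (Lip1 x0) (T ` l2_ball M)" and u: "u \<in> l2_zero_mean M"
  shows "(kr_norm M u)\<^sup>2 \<le> (\<Sum>j. schmidt_weight M T s f u j * (s j)\<^sup>2)"
proof -
  let ?K = "\<Sum>j. schmidt_weight M T s f u j * (s j)\<^sup>2"
  note ul2 = l2_zero_mean_closed[OF u]
  have "kr_norm M u \<le> sqrt ?K"
  proof (rule kr_norm_le[OF u])
    fix h assume h: "h \<in> Lip1 x0"
    then have hl2: "h \<in> l2_space M" by (intro lipschitz_l2_space) (simp add: Lip1_def)
    obtain g where g: "g \<in> l2_ball M" and ae: "AE x in M. h x = T g x"
      using lip h by (auto simp: l2_subset_def)
    have "l2_inner M h u = l2_inner M (T g) u"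
      using g by (intro l2_inner_cong_AE hl2 ul2 ae l2_operator_closed[OF lin]) (simp add: l2_ball_def)
    then show "l2_inner M u h \<le> sqrt ?K"
      using schmidt_inner_le(2)[OF lin S g ul2] by (simp add: l2_inner_commute)
  qed
  then have "(kr_norm M u)\<^sup>2 \<le> (sqrt ?K)\<^sup>2"
    by (intro power_mono kr_norm_nonneg u)
  also have "0 \<le> ?K"
    using schmidt_inner_le(1)[OF lin S _ ul2, of "\<lambda>x. 0"]
    by (intro suminf_nonneg mult_nonneg_nonneg schmidt_weight_nonneg)
      (auto simp: l2_ball_def l2_space_zero l2_norm_zero)
  then have "(sqrt ?K)\<^sup>2 = ?K" by simp
  finally show ?thesis .
qed

text \<open>
  Summation of the Jensen inequality over \<open>k\<close>, with weights \<open>p k j\<close>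
  whose rows and columns have sum at most \<open>1\<close>.
\<close>

lemma (in compact_metric_l2) summable_bessel_kr_norm:
  assumes T: "l2_compact_operator M T"
    and lip: "l2_subset M (Lip1 x0) (T ` l2_ball M)" and sum: "summable (\<lambda>k. \<phi> (singular_number M T k))"
    and bessel: "bessel_sequence M u"
    and \<phi>0: "\<phi> 0 = 0" and nonneg: "\<And>y. 0 \<le> y \<Longrightarrow> 0 \<le> \<phi> y"
    and quot: "\<And>a b. 0 < a \<Longrightarrow> a \<le> b \<Longrightarrow> \<phi> a * b\<^sup>2 \<le> \<phi> b * a\<^sup>2"
  shows "\<exists>a>0. summable (\<lambda>k. \<phi> (a * kr_norm M (u k)))"
proof -
  note lin = l2_compact_operator_linear[OF T]
  define s where "s = singular_number M T"
  obtain f where S: "schmidt_system M T s f"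
    unfolding s_def using schmidt_system_singular_number[OF T] by blast
  have u: "u k \<in> l2_zero_mean M" for k
    using bessel by (simp add: bessel_sequence_def)
  obtain B where "\<forall>g\<in>l2_zero_mean M. summable (\<lambda>k. \<bar>l2_inner M g (u k)\<bar>\<^sup>2) \<and>
      (\<Sum>k. \<bar>l2_inner M g (u k)\<bar>\<^sup>2) \<le> B\<^sup>2 * (l2_norm M g)\<^sup>2"
    using bessel unfolding bessel_sequence_def by (elim conjE exE)
  note B = this[rule_format]
  note ul2 = l2_zero_mean_closed[OF u]
  \<comment> \<open>Any positive constant that is at least $B^2$ would serve; the summand 1 covers $B = 0$.\<close>
  define C where "C = B\<^sup>2 + 1"
  have C: "0 < C" "B\<^sup>2 \<le> C" by (simp_all add: C_def add_nonneg_pos)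
  define p where "p k j = schmidt_weight M T s f (u k) j / C" for k j
  have p0: "0 \<le> p k j" for k j using C by (simp add: p_def schmidt_weight_nonneg)
  have s0: "0 \<le> s j" for j by (rule schmidt_systemD(5)[OF S])
  have u_le: "l2_inner M (u k) (u k) \<le> C" for k
  proof -
    let ?U = "l2_inner M (u k) (u k)"
    have "\<bar>?U\<bar>\<^sup>2 \<le> (\<Sum>i. \<bar>l2_inner M (u k) (u i)\<bar>\<^sup>2)"
      using sum_le_suminf[of "\<lambda>i. \<bar>l2_inner M (u k) (u i)\<bar>\<^sup>2" "{k}"] B[OF u[of k]] by simp
    also have "\<dots> \<le> B\<^sup>2 * ?U" using B[OF u[of k]] by (simp add: l2_norm_squared)
    finally have "?U * ?U \<le> B\<^sup>2 * ?U" by (simp add: power2_eq_square)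
    then have "?U \<le> B\<^sup>2 \<or> ?U = 0"
      using l2_inner_self_nonneg[of M "u k"] by (simp add: mult_le_cancel_right) linarith
    then show ?thesis using C by auto
  qed
  have p_sum: "summable (p k)" "(\<Sum>j. p k j) \<le> 1" for k
  proof -
    note w = schmidt_weight_sum_le[OF lin S ul2[of k]]
    show "summable (p k)"
      unfolding p_def[abs_def] by (rule summable_divide[OF w(1)])
    have "(\<Sum>j. p k j) = (\<Sum>j. schmidt_weight M T s f (u k) j) / C"
      unfolding p_def by (rule suminf_divide[OF w(1)])
    also have "\<dots> \<le> 1" using w(2) u_le[of k] C by (simp add: divide_le_eq)
    finally show "(\<Sum>j. p k j) \<le> 1" .
  qed
  have p_column: "(\<Sum>k<n. p k j) \<le> 1" for n j
  proof -
    have "(\<Sum>k<n. p k j) = (\<Sum>k<n. schmidt_weight M T s f (u k) j) / C"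
      by (simp add: p_def sum_divide_distrib)
    also have "\<dots> \<le> 1"
      using schmidt_weight_bessel_sum_le[OF lin S u B, of j n] C by (simp add: divide_le_eq)
    finally show ?thesis .
  qed
  have sum_s: "summable (\<lambda>j. \<phi> (s j))" using sum by (simp add: s_def)
  have sum_p\<phi>: "summable (\<lambda>j. p k j * \<phi> (s j))" for k
  proof (rule summable_comparison_test_ev[OF _ sum_s])
    have "p k j \<le> 1" for j
      using p_column[of j "Suc k"] sum_nonneg[of "{..<k}" "\<lambda>i. p i j"] p0 by simp
    then have "p k j * \<phi> (s j) \<le> 1 * \<phi> (s j)" for j
      by (intro mult_right_mono nonneg s0)
    then show "\<forall>\<^sub>F j in sequentially. norm (p k j * \<phi> (s j)) \<le> \<phi> (s j)"
      using p0 nonneg[OF s0] by simp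
  qed
  \<comment> \<open>This $a$ turns $\|u_k\|_{KR}^2 \le C \sum_j p_{kj} s_j^2$ into the hypothesis of the Jensen inequality.\<close>
  define a where "a = 1 / sqrt (2 * C)"
  have a: "0 < a" using C by (simp add: a_def)
  have single: "\<phi> (a * kr_norm M (u k)) \<le> (\<Sum>j. p k j * \<phi> (s j))" for k
  proof (cases "kr_norm M (u k) = 0")
    case True
    then show ?thesis
      using \<phi>0 p0 nonneg[OF s0] by (simp add: suminf_nonneg[OF sum_p\<phi>])
  next
    case False
    then have pos: "0 < a * kr_norm M (u k)"
      using kr_norm_nonneg[OF u, of k] a by simp
    have zero_ball: "(\<lambda>x. 0) \<in> l2_ball M"
      by (simp add: l2_ball_def l2_space_zero l2_norm_zero)
    note w = schmidt_inner_le(1)[OF lin S zero_ball ul2[of k]]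
    have p_eq: "(\<lambda>j. p k j * (s j)\<^sup>2) = (\<lambda>j. schmidt_weight M T s f (u k) j * (s j)\<^sup>2 / C)"
      by (simp add: p_def)
    have "2 * (a * kr_norm M (u k))\<^sup>2 = (kr_norm M (u k))\<^sup>2 / C"
      using C by (simp add: a_def power_mult_distrib power_divide)
    also have "\<dots> \<le> (\<Sum>j. p k j * (s j)\<^sup>2)"
      unfolding p_eq suminf_divide[OF w]
      using kr_norm_le_schmidt[OF lin S lip u] C by (intro divide_right_mono) auto
    finally show ?thesis
      using p_eq summable_divide[OF w, of C]
      by (intro half_quadratic_jensen[OF nonneg quot p0 p_sum s0 _ sum_p\<phi> pos]) auto
  qed
  have "(\<Sum>k<n. \<phi> (a * kr_norm M (u k))) \<le> (\<Sum>j. \<phi> (s j))" for n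
  proof -
    have "(\<Sum>k<n. \<phi> (a * kr_norm M (u k))) \<le> (\<Sum>k<n. \<Sum>j. p k j * \<phi> (s j))"
      by (rule sum_mono[OF single])
    also have "\<dots> = (\<Sum>j. \<Sum>k<n. p k j * \<phi> (s j))"
      by (rule suminf_sum[symmetric]) (rule sum_p\<phi>)
    also have "\<dots> \<le> (\<Sum>j. \<phi> (s j))"
    proof (rule suminf_le)
      show "(\<Sum>k<n. p k j * \<phi> (s j)) \<le> \<phi> (s j)" for j
        using mult_right_mono[OF p_column nonneg[OF s0], of j n j] by (simp add: sum_distrib_right)
    qed (intro summable_sum sum_p\<phi>, rule sum_s)
    finally show ?thesis .
  qed
  then have "summable (\<lambda>k. \<phi> (a * kr_norm M (u k)))"
    using a kr_norm_nonneg[OF u] by (intro summableI_nonneg_bounded nonneg) auto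
  with a show ?thesis by blast
qed

section \<open>Kantorovich-Rubinstein norms and singular numbers\<close>

theorem theorem3p2:
  fixes m :: "'a::metric_space measure"
    and T :: "('a \<Rightarrow> real) \<Rightarrow> 'a \<Rightarrow> real"
    and \<phi> r :: "real \<Rightarrow> real"
    and x0 :: 'a
  assumes compact_space: "compact (UNIV :: 'a set)"
    and borel_m: "sets m = sets borel"
    and prob_m: "prob_space m"
    and no_point_masses: "\<And>x. emeasure m {x} = 0"
    and compact_T: "l2_compact_operator m T"
    and cont_phi: "continuous_on {0..} \<phi>"
    and incr_phi: "strict_mono_on {0..} \<phi>"
    and range_phi: "\<phi> ` {0..} = {0..}"
    and inverse_phi:
      "\<And>x. 0 < x \<Longrightarrow> the_inv_into {0..} \<phi> x = x powr (1/2) * r (x powr (-1/2))"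
    and r: "concave_on {0<..} r \<or> pseudo_concave r"
  shows
    "(l2_subset m (Lip1 x0) (T ` l2_ball m) \<and> summable (\<lambda>k. \<phi> (singular_number m T k)) \<longrightarrow>
        (\<forall>u. bessel_sequence m u \<longrightarrow> (\<exists>a>0. summable (\<lambda>k. \<phi> (a * kr_norm m (u k))))))
     \<and>
     (l2_subset m (T ` l2_ball m) (Lip1 x0) \<longrightarrow>
        (\<exists>u. l2_orthonormal m UNIV u \<and> (\<forall>k. u k \<in> l2_zero_mean m) \<and>
           (T ` l2_space m \<subseteq> l2_zero_mean m \<longrightarrow> (\<forall>k. singular_number m T k \<le> kr_norm m (u k))) \<and>
           (\<forall>k. singular_number m (l2_center m \<circ> T) k \<le> kr_norm m (u k)) \<and>
           (\<forall>k. singular_number m T (Suc k) \<le> kr_norm m (u k)) \<and>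
           (\<forall>h :: real \<Rightarrow> real. mono_on {0..} h \<and> (\<forall>t\<ge>0. 0 \<le> h t) \<and>
                \<not> summable (\<lambda>k. h (singular_number m T k)) \<longrightarrow>
                \<not> summable (\<lambda>k. h (kr_norm m (u k))))))"
proof (intro conjI impI allI)
  interpret infinite_dim_l2 m
    by (rule no_point_masses_infinite_dim_l2[OF compact_space borel_m prob_m no_point_masses])
  interpret compact_metric_l2 m
    by unfold_locales (fact compact_space borel_m)+
  have nonneg: "0 \<le> \<phi> y" if "0 \<le> y" for y using range_phi that by auto
  have phi_0: "\<phi> 0 = 0"
  proof -
    obtain z where z: "0 \<le> z" "\<phi> z = 0" using range_phi by (metis atLeast_iff imageE order_refl)
    then show ?thesis
      using strict_mono_onD[OF incr_phi, of 0 z] nonneg[of 0] by (cases "z = 0") auto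
  qed
  note quot = quotient_by_square_mono[OF incr_phi range_phi inverse_phi r]
  show "\<exists>a>0. summable (\<lambda>k. \<phi> (a * kr_norm m (u k)))"
    if "l2_subset m (Lip1 x0) (T ` l2_ball m) \<and> summable (\<lambda>k. \<phi> (singular_number m T k))"
      "bessel_sequence m u" for u
    using that by (intro summable_bessel_kr_norm[OF compact_T _ _ _ phi_0 nonneg quot]) auto
  assume "l2_subset m (T ` l2_ball m) (Lip1 x0)"
  then obtain u where u: "l2_orthonormal m UNIV u" "\<forall>k. u k \<in> l2_zero_mean m"
    "\<forall>k. singular_number m (l2_center m \<circ> T) k \<le> kr_norm m (u k)"
    using ex_orthonormal_kr_norm_ge[OF compact_T] by blast
  obtain f where S: "schmidt_system m T (singular_number m T) f"
    using schmidt_system_singular_number[OF compact_T] by blast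
  obtain g where A: "schmidt_system m (l2_center m \<circ> T) (singular_number m (l2_center m \<circ> T)) g"
    using schmidt_system_singular_number[OF l2_center_compact_operator[OF compact_T]] by blast
  have shifted: "\<forall>k. singular_number m T (Suc k) \<le> kr_norm m (u k)"
    using schmidt_center_interlacing[OF l2_compact_operator_linear[OF compact_T] S A] u(3)
      order_trans by blast
  have centred: "\<forall>k. singular_number m T k \<le> kr_norm m (u k)"
    if zero: "T ` l2_space m \<subseteq> l2_zero_mean m"
  proof -
    have "(l2_center m \<circ> T) v = T v" if "v \<in> l2_space m" for v
    proof -
      have "T v \<in> l2_zero_mean m" using zero that by blast
      then show ?thesis by (simp add: l2_center_def l2_zero_mean_def)
    qed
    then have "singular_number m (l2_center m \<circ> T) = singular_number m T"
      by (rule singular_number_cong)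
    with u(3) show ?thesis by simp
  qed
  have "\<forall>h :: real \<Rightarrow> real. mono_on {0..} h \<and> (\<forall>t\<ge>0. 0 \<le> h t) \<and>
      \<not> summable (\<lambda>k. h (singular_number m T k)) \<longrightarrow> \<not> summable (\<lambda>k. h (kr_norm m (u k)))"
    using not_summable_mono_shift[where s = "singular_number m T" and t = "\<lambda>k. kr_norm m (u k)"]
      schmidt_systemD(5)[OF S] shifted by blast
  with u shifted centred
  show "\<exists>u. l2_orthonormal m UNIV u \<and> (\<forall>k. u k \<in> l2_zero_mean m) \<and>
      (T ` l2_space m \<subseteq> l2_zero_mean m \<longrightarrow> (\<forall>k. singular_number m T k \<le> kr_norm m (u k))) \<and>
      (\<forall>k. singular_number m (l2_center m \<circ> T) k \<le> kr_norm m (u k)) \<and>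
      (\<forall>k. singular_number m T (Suc k) \<le> kr_norm m (u k)) \<and>
      (\<forall>h :: real \<Rightarrow> real. mono_on {0..} h \<and> (\<forall>t\<ge>0. 0 \<le> h t) \<and>
        \<not> summable (\<lambda>k. h (singular_number m T k)) \<longrightarrow> \<not> summable (\<lambda>k. h (kr_norm m (u k))))"
    by blast
qed

end
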